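(* Let $d\in\mathbb N$ and let $\Omega\subset\mathbb R^d$ be a bounded domain. Let $\omega\in\mathbb R$ be a given frequency and $p\in\mathbb N$, and set $T:=2\pi p/\omega$, where $T>0$. Let $\lambda>0$ and let $I\colon[0,T]\times\Omega\to\mathbb R$ be an image sequence of class $C^1$. Consider the functional $$E(v)=\int_\Omega\int_0^T\Big(\big|\nabla I(t,x)^{\mathrm T}v(t,x)+\partial_tI(t,x)\big|^2+\lambda\|\nabla v(t,x)\|^2\Big)\,\mathrm dt\,\mathrm dx$$ on the set of time-harmonic velocity fields $v\colon[0,T]\times\Omega\to\mathbb R^d$ of the form $v(t,x)=\operatorname{Re}\big(a(x)\,\mathrm e^{\mathrm i t\omega}\big)$ with amplitude $a\colon\Omega\to\mathbb C^d$ of class $C^2$. If $v$ is a minimizer of $E$ over this set (with $E(v)<\infty$), then its amplitude $a$ satisfies, for all $x\in\Omega$, $$\lambda T\,\Delta a(x)=\mathcal F[\nabla I\,\nabla I^{\mathrm T}](2\omega,x)\,\overline{a(x)}+\mathcal F[\nabla I\,\nabla I^{\mathrm T}](0,x)\,a(x)+2\,\mathcal F[\partial_tI\,\nabla I](\omega,x).$$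
   Context: $\nabla$ denotes the gradient (for vector-valued functions, the Jacobian) with respect to the spatial variable $x\in\mathbb R^d$ only, and $\nabla I$ is a column vector. $\|\cdot\|$ is the Frobenius norm, so $\|\nabla v\|^2=\sum_{j,k=1}^d|\partial_{x_j}v_k|^2$. $\Delta$ is the spatial Laplace operator applied componentwise, and $\overline{a}$ is the componentwise complex conjugate. $\mathcal F$ is the Fourier transform in the time variable with $x$ fixed, applied entrywise to vector- or matrix-valued functions: for $f$ defined on $[0,T]\times\Omega$, $\mathcal F[f](\nu,x)=\int_0^Tf(t,x)\,\mathrm e^{-\mathrm i t\nu}\,\mathrm dt$ for $\nu\in\mathbb R$. *)

theory Defs
  imports "HOL-Analysis.Analysis"
begin

text \<open>
  Derivatives are taken within \<open>S\<close>. For open \<open>S\<close> this is the usual notion; for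
  \<open>{0..T} \<times> \<Omega>\<close> with \<open>\<Omega>\<close> open it is one-sided in time at the two end points.
\<close>

definition C1_on :: "'a::real_normed_vector set \<Rightarrow> ('a \<Rightarrow> 'b::real_normed_vector) \<Rightarrow> bool" where
  "C1_on S f \<longleftrightarrow>
     (\<exists>f'. (\<forall>x\<in>S. (f has_derivative blinfun_apply (f' x)) (at x within S)) \<and> continuous_on S f')"

definition C2_on :: "'a::real_normed_vector set \<Rightarrow> ('a \<Rightarrow> 'b::real_normed_vector) \<Rightarrow> bool" where
  "C2_on S f \<longleftrightarrow>
     (\<exists>f'. (\<forall>x\<in>S. (f has_derivative blinfun_apply (f' x)) (at x within S)) \<and> C1_on S f')"

definition pderiv_at :: "'n::finite \<Rightarrow> (real^'n \<Rightarrow> 'b::real_normed_vector) \<Rightarrow> real^'n \<Rightarrow> 'b" where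
  "pderiv_at j f x = vector_derivative (\<lambda>s. f (x + s *\<^sub>R axis j 1)) (at 0)"

definition grad :: "(real^'n::finite \<Rightarrow> real) \<Rightarrow> real^'n \<Rightarrow> real^'n" where
  "grad f x = (\<chi> j. pderiv_at j f x)"

definition jacobian :: "(real^'n::finite \<Rightarrow> real^'m::finite) \<Rightarrow> real^'n \<Rightarrow> real^'n^'m" where
  "jacobian f x = (\<chi> k j. pderiv_at j (\<lambda>y. f y $ k) x)"

definition laplacian :: "(real^'n::finite \<Rightarrow> complex^'m::finite) \<Rightarrow> real^'n \<Rightarrow> complex^'m" where
  "laplacian f x = (\<chi> k. \<Sum>j\<in>UNIV. pderiv_at j (pderiv_at j (\<lambda>y. f y $ k)) x)"

definition dt :: "real \<Rightarrow> (real \<Rightarrow> 'x \<Rightarrow> real) \<Rightarrow> real \<Rightarrow> 'x \<Rightarrow> real" where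
  "dt T f t x = vector_derivative (\<lambda>s. f s x) (at t within {0..T})"

definition outer :: "real^'n::finite \<Rightarrow> real^'n \<Rightarrow> real^'n^'n" where
  "outer u w = (\<chi> j k. u $ j * w $ k)"

definition fourier :: "real \<Rightarrow> (real \<Rightarrow> 'x \<Rightarrow> real) \<Rightarrow> real \<Rightarrow> 'x \<Rightarrow> complex" where
  "fourier T f \<nu> x =
     (LINT t:{0..T}|lborel. complex_of_real (f t x) * exp (- (\<i> * complex_of_real (t * \<nu>))))"

definition fourier_vec ::
  "real \<Rightarrow> (real \<Rightarrow> 'x \<Rightarrow> real^'n::finite) \<Rightarrow> real \<Rightarrow> 'x \<Rightarrow> complex^'n" where
  "fourier_vec T f \<nu> x = (\<chi> j. fourier T (\<lambda>t y. f t y $ j) \<nu> x)"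

definition fourier_mat ::
  "real \<Rightarrow> (real \<Rightarrow> 'x \<Rightarrow> real^'n::finite^'m::finite) \<Rightarrow> real \<Rightarrow> 'x \<Rightarrow> complex^'n^'m" where
  "fourier_mat T f \<nu> x = (\<chi> j k. fourier T (\<lambda>t y. f t y $ j $ k) \<nu> x)"

definition cnj_vec :: "complex^'n::finite \<Rightarrow> complex^'n" where
  "cnj_vec a = (\<chi> k. cnj (a $ k))"

text \<open>
  The integrand is nonnegative, so the functional takes values in \<open>[0, \<infinity>]\<close>. The library
  norm on \<open>real^'n^'n\<close> is the Frobenius norm.
\<close>

definition energy ::
  "real \<Rightarrow> (real^'n::finite) set \<Rightarrow> real \<Rightarrow> (real \<Rightarrow> real^'n \<Rightarrow> real) \<Rightarrow>
   (real \<Rightarrow> real^'n \<Rightarrow> real^'n) \<Rightarrow> ennreal" where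
  "energy T \<Omega> lam I v =
     (\<integral>\<^sup>+x\<in>\<Omega>. (\<integral>\<^sup>+t\<in>{0..T}.
        ennreal (\<bar>grad (I t) x \<bullet> v t x + dt T I t x\<bar>\<^sup>2 + lam * (norm (jacobian (v t) x))\<^sup>2)
      \<partial>lborel) \<partial>lborel)"

definition has_amplitude ::
  "real \<Rightarrow> (real^'n::finite) set \<Rightarrow> real \<Rightarrow> (real \<Rightarrow> real^'n \<Rightarrow> real^'n) \<Rightarrow>
   (real^'n \<Rightarrow> complex^'n) \<Rightarrow> bool" where
  "has_amplitude T \<Omega> \<omega> v a \<longleftrightarrow>
     C2_on \<Omega> a \<and>
     (\<forall>t\<in>{0..T}. \<forall>x\<in>\<Omega>. v t x = (\<chi> k. Re (a x $ k * exp (\<i> * complex_of_real (t * \<omega>)))))"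

definition harmonic_fields ::
  "real \<Rightarrow> (real^'n::finite) set \<Rightarrow> real \<Rightarrow> (real \<Rightarrow> real^'n \<Rightarrow> real^'n) set" where
  "harmonic_fields T \<Omega> \<omega> = {v. \<exists>a. has_amplitude T \<Omega> \<omega> v a}"

end

theory Submission
  imports Defs
begin

text \<open>
  Perturb the amplitude \<open>a\<close> of the minimizer by \<open>s \<phi> c\<close>, with \<open>c\<close> a constant complex vector and
  \<open>\<phi>\<close> a radial \<open>C\<^sup>2\<close> bump supported in a small ball. The energy is a quadratic polynomial in \<open>s\<close>
  that is minimal at \<open>s = 0\<close>, so its linear coefficient vanishes. As \<open>T\<close> is a multiple of the period,
  integrating \<open>Re (w exp (i \<omega> t)) Re (z exp (i \<omega> t))\<close> over \<open>[0, T]\<close> gives \<open>T/2\<close> times the real inner product of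
  \<open>w\<close> and \<open>z\<close>. Integrating the gradient term by parts in space turns the linear coefficient into the
  integral of \<open>\<phi> (c \<bullet> Q)\<close>, where \<open>Q = W - (\<lambda> T / 2) \<Delta> a\<close> and
  \<open>W\<close> is the Fourier coefficient at \<open>\<omega>\<close> of \<open>(\<nabla>I \<bullet> v + \<partial>\<^sub>tI) \<nabla>I\<close>. Hence \<open>Q = 0\<close>, and expanding
  \<open>v = (a exp (i \<omega> t) + cnj a exp (- i \<omega> t)) / 2\<close> in \<open>W\<close> produces the three Fourier terms.
\<close>

section \<open>Calculus of continuously differentiable maps\<close>

lemma C1_onE:
  assumes "C1_on S f"
  obtains f' where "\<And>x. x \<in> S \<Longrightarrow> (f has_derivative blinfun_apply (f' x)) (at x within S)"
    "continuous_on S f'"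
  using assms unfolding C1_on_def by blast

lemma C2_onE:
  assumes "C2_on S f"
  obtains f' where "\<And>x. x \<in> S \<Longrightarrow> (f has_derivative blinfun_apply (f' x)) (at x within S)"
    "C1_on S f'"
  using assms unfolding C2_on_def by blast

lemma C1_onI:
  assumes "\<And>x. x \<in> S \<Longrightarrow> (f has_derivative blinfun_apply (f' x)) (at x within S)"
    "continuous_on S f'"
  shows "C1_on S f"
  using assms unfolding C1_on_def by blast

lemma C2_onI:
  assumes "\<And>x. x \<in> S \<Longrightarrow> (f has_derivative blinfun_apply (f' x)) (at x within S)"
    "C1_on S f'"
  shows "C2_on S f"
  using assms unfolding C2_on_def by blast

lemma C1_on_continuous_on: "C1_on S f \<Longrightarrow> continuous_on S f"
  by (metis C1_onE continuous_on_eq_continuous_within has_derivative_continuous)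

lemma C2_on_C1_on: "C2_on S f \<Longrightarrow> C1_on S f"
  by (metis C1_onI C1_on_continuous_on C2_onE)

lemma C1_on_const: "C1_on S (\<lambda>x. c)"
  by (rule C1_onI[where f' = "\<lambda>x. 0"]) (auto intro!: derivative_eq_intros)

lemma C1_on_ident: "C1_on S (\<lambda>x. x)"
  by (rule C1_onI[where f' = "\<lambda>x. id_blinfun"]) (auto intro!: derivative_eq_intros)

lemma C1_on_add:
  assumes "C1_on S f" "C1_on S g"
  shows "C1_on S (\<lambda>x. f x + g x)"
proof -
  obtain f' where f: "\<And>x. x \<in> S \<Longrightarrow> (f has_derivative blinfun_apply (f' x)) (at x within S)"
    "continuous_on S f'" by (rule C1_onE[OF assms(1)]) blast
  obtain g' where g: "\<And>x. x \<in> S \<Longrightarrow> (g has_derivative blinfun_apply (g' x)) (at x within S)"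
    "continuous_on S g'" by (rule C1_onE[OF assms(2)]) blast
  show ?thesis
    by (rule C1_onI[where f' = "\<lambda>x. f' x + g' x"])
      (auto intro!: derivative_eq_intros continuous_intros f g simp: blinfun.add_left)
qed

lemma C1_on_scaleR:
  fixes f :: "'a::real_normed_vector \<Rightarrow> real"
  assumes "C1_on S f" "C1_on S g"
  shows "C1_on S (\<lambda>x. f x *\<^sub>R g x)"
proof -
  obtain f' where f: "\<And>x. x \<in> S \<Longrightarrow> (f has_derivative blinfun_apply (f' x)) (at x within S)"
    "continuous_on S f'" by (rule C1_onE[OF assms(1)]) blast
  obtain g' where g: "\<And>x. x \<in> S \<Longrightarrow> (g has_derivative blinfun_apply (g' x)) (at x within S)"
    "continuous_on S g'" by (rule C1_onE[OF assms(2)]) blast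
  show ?thesis
    by (rule C1_onI[where f' = "\<lambda>x. f x *\<^sub>R g' x + (blinfun_scaleR_left (g x) o\<^sub>L f' x)"])
      (auto intro!: derivative_eq_intros continuous_intros f g assms[THEN C1_on_continuous_on]
        simp: blinfun.add_left blinfun.scaleR_left)
qed

lemma C1_on_bounded_linear:
  assumes "bounded_linear h" "C1_on S f"
  shows "C1_on S (\<lambda>x. h (f x))"
proof -
  obtain f' where f: "\<And>x. x \<in> S \<Longrightarrow> (f has_derivative blinfun_apply (f' x)) (at x within S)"
    "continuous_on S f'" by (rule C1_onE[OF assms(2)]) blast
  show ?thesis
  proof (rule C1_onI[where f' = "\<lambda>x. Blinfun h o\<^sub>L f' x"])
    show "((\<lambda>x. h (f x)) has_derivative blinfun_apply (Blinfun h o\<^sub>L f' x)) (at x within S)"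
      if "x \<in> S" for x
      using bounded_linear.has_derivative[OF assms(1) f(1)[OF that]]
      by (simp add: bounded_linear_Blinfun_apply[OF assms(1)] blinfun_compose.rep_eq o_def)
  qed (auto intro!: continuous_intros f)
qed

text \<open>Chain rule for an outer function that is differentiable on the whole line. It serves the
  truncated power in the bump.\<close>

lemma C1_on_compose_real:
  fixes f :: "'a::real_normed_vector \<Rightarrow> real"
  assumes "C1_on S f" "\<And>y. (h has_real_derivative h' y) (at y)" "continuous_on UNIV h'"
  shows "C1_on S (\<lambda>x. h (f x))"
proof -
  obtain f' where f: "\<And>x. x \<in> S \<Longrightarrow> (f has_derivative blinfun_apply (f' x)) (at x within S)"
    "continuous_on S f'" by (rule C1_onE[OF assms(1)]) blast
  show ?thesis
  proof (rule C1_onI[where f' = "\<lambda>x. h' (f x) *\<^sub>R f' x"])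
    fix x assume "x \<in> S"
    from has_derivative_compose[OF f(1)[OF this] assms(2)[unfolded has_field_derivative_def]]
    show "((\<lambda>x. h (f x)) has_derivative blinfun_apply (h' (f x) *\<^sub>R f' x)) (at x within S)"
      by (simp add: blinfun.scaleR_left[abs_def])
  next
    show "continuous_on S (\<lambda>x. h' (f x) *\<^sub>R f' x)"
      using continuous_on_compose2[OF assms(3) C1_on_continuous_on[OF assms(1)]]
      by (auto intro!: continuous_intros f)
  qed
qed

lemma C2_on_add:
  assumes "C2_on S f" "C2_on S g"
  shows "C2_on S (\<lambda>x. f x + g x)"
proof -
  obtain f' where f: "\<And>x. x \<in> S \<Longrightarrow> (f has_derivative blinfun_apply (f' x)) (at x within S)"
    "C1_on S f'" by (rule C2_onE[OF assms(1)]) blast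
  obtain g' where g: "\<And>x. x \<in> S \<Longrightarrow> (g has_derivative blinfun_apply (g' x)) (at x within S)"
    "C1_on S g'" by (rule C2_onE[OF assms(2)]) blast
  show ?thesis unfolding C2_on_def
    by (rule exI[where x = "\<lambda>x. f' x + g' x"])
      (auto intro!: derivative_eq_intros C1_on_add f g simp: blinfun.add_left)
qed

lemma C2_on_bounded_linear:
  assumes "bounded_linear h" "C2_on S f"
  shows "C2_on S (\<lambda>x. h (f x))"
proof -
  obtain f' where f: "\<And>x. x \<in> S \<Longrightarrow> (f has_derivative blinfun_apply (f' x)) (at x within S)"
    "C1_on S f'" by (rule C2_onE[OF assms(2)]) blast
  have "C1_on S (\<lambda>x. Blinfun h o\<^sub>L f' x)"
    by (rule C1_on_bounded_linear[OF _ f(2)])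
      (rule bounded_bilinear.bounded_linear_right[OF bounded_bilinear_blinfun_compose])
  then show ?thesis
  proof (rule C2_onI[rotated])
    fix x assume "x \<in> S"
    then show "((\<lambda>x. h (f x)) has_derivative blinfun_apply (Blinfun h o\<^sub>L f' x)) (at x within S)"
    using bounded_linear.has_derivative[OF assms(1) f(1)]
    by (simp add: bounded_linear_Blinfun_apply[OF assms(1)] blinfun_compose.rep_eq o_def)
  qed
qed

text \<open>\<open>pderiv_at\<close> looks at \<open>f\<close> only along one axis. The chain rule
  along that line identifies its value through the total derivative, the form in which
  \<open>C1_on\<close> and \<open>C2_on\<close> supply it.\<close>

lemma pderiv_at_eq:
  assumes "(f has_derivative f') (at x)"
  shows "pderiv_at j f x = f' (axis j 1)"
    and "((\<lambda>s. f (x + s *\<^sub>R axis j 1)) has_vector_derivative f' (axis j 1)) (at 0)"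
proof -
  have "((\<lambda>s. x + s *\<^sub>R axis j 1) has_derivative (\<lambda>s. s *\<^sub>R axis j 1)) (at (0::real))"
    by (auto intro!: derivative_eq_intros)
  from has_derivative_compose[OF this, of f f'] assms
  have "((\<lambda>s. f (x + s *\<^sub>R axis j 1)) has_derivative (\<lambda>s. f' (s *\<^sub>R axis j 1))) (at 0)"
    by simp
  moreover have "f' (s *\<^sub>R axis j 1) = s *\<^sub>R f' (axis j 1)" for s
    using assms by (simp add: has_derivative_bounded_linear linear_simps(5))
  ultimately show *: "((\<lambda>s. f (x + s *\<^sub>R axis j 1)) has_vector_derivative f' (axis j 1)) (at 0)"
    by (simp add: has_vector_derivative_def)
  show "pderiv_at j f x = f' (axis j 1)"
    unfolding pderiv_at_def by (rule vector_derivative_at[OF *])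
qed

lemma C1_on_pderiv_at:
  assumes "open S" "C1_on S f"
  shows "x \<in> S \<Longrightarrow> ((\<lambda>s. f (x + s *\<^sub>R axis j 1)) has_vector_derivative pderiv_at j f x) (at 0)"
    and "continuous_on S (pderiv_at j f)"
proof -
  obtain f' where f: "\<And>x. x \<in> S \<Longrightarrow> (f has_derivative blinfun_apply (f' x)) (at x within S)"
    "continuous_on S f'" by (rule C1_onE[OF assms(2)]) blast
  have eq: "pderiv_at j f x = f' x (axis j 1)"
    "((\<lambda>s. f (x + s *\<^sub>R axis j 1)) has_vector_derivative f' x (axis j 1)) (at 0)"
    if "x \<in> S" for x
    using pderiv_at_eq[of f "f' x" x j] f(1)[OF that] at_within_open[OF that assms(1)] by simp_all
  show "x \<in> S \<Longrightarrow> ((\<lambda>s. f (x + s *\<^sub>R axis j 1)) has_vector_derivative pderiv_at j f x) (at 0)"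
    using eq by simp
  show "continuous_on S (pderiv_at j f)"
    by (subst continuous_on_cong[OF refl eq(1)]) (auto intro!: continuous_intros f)
qed

lemma C1_on_cong:
  assumes "\<And>x. x \<in> S \<Longrightarrow> f x = g x" "C1_on S f"
  shows "C1_on S g"
  using assms(2) unfolding C1_on_def
  by (metis (no_types, lifting) assms(1) has_derivative_transform)

lemma C2_on_pderiv_at:
  assumes "open S" "C2_on S f"
  shows "C1_on S (pderiv_at j f)"
proof -
  obtain f' where f: "\<And>x. x \<in> S \<Longrightarrow> (f has_derivative blinfun_apply (f' x)) (at x within S)"
    "C1_on S f'" by (rule C2_onE[OF assms(2)]) blast
  have eq: "pderiv_at j f x = f' x (axis j 1)" if "x \<in> S" for x
    using pderiv_at_eq[of f "f' x" x j] f(1)[OF that] at_within_open[OF that assms(1)] by simp_all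
  have "C1_on S (\<lambda>x. f' x (axis j 1))"
    by (rule C1_on_bounded_linear[OF _ f(2)])
      (rule bounded_bilinear.bounded_linear_left[OF bounded_bilinear_blinfun_apply])
  then show ?thesis by (rule C1_on_cong[rotated]) (simp add: eq)
qed

text \<open>Locality: for small \<open>s\<close> the point \<open>x + s *\<^sub>R e\<close> stays in
  the open set, and a derivative at 0 sees nothing else.\<close>

lemma has_vector_derivative_line_cong:
  fixes x e :: "'a::real_normed_vector"
  assumes "open S" "x \<in> S" "\<And>y. y \<in> S \<Longrightarrow> f y = g y"
  shows "((\<lambda>s. f (x + s *\<^sub>R e)) has_vector_derivative D) (at 0) \<longleftrightarrow>
    ((\<lambda>s. g (x + s *\<^sub>R e)) has_vector_derivative D) (at 0)"
proof -
  have "((\<lambda>s::real. x + s *\<^sub>R e) \<longlongrightarrow> x + 0 *\<^sub>R e) (nhds 0)"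
    by (intro tendsto_intros) (simp add: filterlim_def)
  then have "\<forall>\<^sub>F s in nhds (0::real). x + s *\<^sub>R e \<in> S"
    using assms by (auto simp: tendsto_def)
  then show ?thesis
    by (intro has_vector_derivative_cong_ev)
      (auto elim!: eventually_mono simp: assms)
qed

text \<open>\<open>vector_derivative\<close> is a choice among the possible derivatives, and by
  locality both sides choose from the same candidates.\<close>

lemma pderiv_at_cong:
  assumes "open S" "x \<in> S" "\<And>y. y \<in> S \<Longrightarrow> f y = g y"
  shows "pderiv_at j f x = pderiv_at j g x"
  unfolding pderiv_at_def vector_derivative_def
  using has_vector_derivative_line_cong[of S x f g, OF assms] by simp

text \<open>Used with real-linear maps: taking real parts after multiplication by an exponential,
  scaling, and real inner products with a fixed vector.\<close>

lemma pderiv_at_bounded_linear: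
  assumes "open S" "C1_on S f" "bounded_linear h" "x \<in> S"
  shows "pderiv_at j (\<lambda>y. h (f y)) x = h (pderiv_at j f x)"
  unfolding pderiv_at_def[of j "\<lambda>y. h (f y)"]
  by (rule vector_derivative_at, rule bounded_linear.has_vector_derivative[OF assms(3)])
    (rule C1_on_pderiv_at(1)[OF assms(1,2,4)])

lemma pderiv_at_add:
  assumes "open S" "C1_on S f" "C1_on S g" "x \<in> S"
  shows "pderiv_at j (\<lambda>y. f y + g y) x = pderiv_at j f x + pderiv_at j g x"
  unfolding pderiv_at_def[of j "\<lambda>y. f y + g y"]
  by (rule vector_derivative_at, rule has_vector_derivative_add)
    (rule C1_on_pderiv_at(1)[OF assms(1) _ assms(4)], rule assms)+

text \<open>The exponent 3 makes this test function of class \<open>C\<^sup>2\<close>.\<close>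

definition bump :: "'a::real_inner \<Rightarrow> real \<Rightarrow> 'a \<Rightarrow> real" where
  "bump c r x = max 0 (r\<^sup>2 - (norm (x - c))\<^sup>2) ^ 3"

text \<open>Away from 0 the function coincides locally with a power or with 0. At 0 the two pieces
  join because the exponent is at least 2.\<close>

lemma has_real_derivative_max_power:
  "((\<lambda>y. max 0 y ^ Suc (Suc n)) has_real_derivative (real (n + 2) * max 0 y ^ Suc n)) (at y)"
proof -
  consider "y > 0" | "y < 0" | "y = 0" by linarith
  then show ?thesis
  proof cases
    case 1
    have "((\<lambda>y. y ^ Suc (Suc n)) has_real_derivative (real (n + 2) * max 0 y ^ Suc n)) (at y)"
      by (rule DERIV_cong[OF DERIV_pow]) (use 1 in simp)
    then show ?thesis
      by (rule DERIV_cong_ev[THEN iffD1, rotated -1])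
        (use eventually_nhds_in_open[of "{0<..}" y] 1 in \<open>auto elim!: eventually_mono\<close>)
  next
    case 2
    have "((\<lambda>y. 0) has_real_derivative (real (n + 2) * max 0 y ^ Suc n)) (at y)"
      using 2 by (auto intro!: derivative_eq_intros)
    then show ?thesis
      by (rule DERIV_cong_ev[THEN iffD1, rotated -1])
        (use eventually_nhds_in_open[of "{..<0}" y] 2 in \<open>auto elim!: eventually_mono\<close>)
  next
    \<comment> \<open>The difference quotient at 0 loses one factor: it is \<open>h ^ Suc n\<close>
      for positive \<open>h\<close> and 0 for negative \<open>h\<close>, so it tends to 0.\<close>
    case 3
    have "\<forall>\<^sub>F h in at (0::real). max 0 h ^ n * max 0 h = max 0 h ^ Suc (Suc n) / h"
      by (auto simp: eventually_at_filter max_def power_Suc2)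
    moreover have "((\<lambda>h. max 0 h ^ n * max 0 h) \<longlongrightarrow> max 0 0 ^ n * max 0 (0::real)) (at 0)"
      by (intro tendsto_intros)
    ultimately have "((\<lambda>h::real. max 0 h ^ Suc (Suc n) / h) \<longlongrightarrow> max 0 0 ^ n * max 0 (0::real)) (at 0)"
      by (rule Lim_transform_eventually[rotated])
    then show ?thesis using 3 by (simp add: DERIV_def)
  qed
qed

text \<open>The chain rule for the truncated cube of the quadratic \<open>q\<close> gives the
  derivative \<open>3 * max 0 (q x) ^ 2\<close> times \<open>q'\<close>. The truncated square is
  still continuously differentiable, with derivative \<open>6 * max 0 y\<close> after the factor 3,
  so this product is of class \<open>C1_on\<close>.\<close>

lemma C2_on_bump: "C2_on S (bump c r)"
proof -
  define q where "q x = r\<^sup>2 - (norm (x - c))\<^sup>2" for x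
  define q' where "q' x = (-2) *\<^sub>R blinfun_inner_right (x - c)" for x
  have q': "(q has_derivative blinfun_apply (q' x)) (at x within S)" for x
    unfolding q_def q'_def power2_norm_eq_inner
    by (auto intro!: derivative_eq_intros simp: blinfun.scaleR_left blinfun.minus_left inner_commute)
  have "C1_on S (\<lambda>x. x + (- c))" by (intro C1_on_add C1_on_ident C1_on_const)
  then have C1q': "C1_on S q'"
    unfolding q'_def
    using C1_on_bounded_linear[OF bounded_linear_scaleR_right[of "-2"]
        C1_on_bounded_linear[OF bounded_linear_blinfun_inner_right]] by force
  then have "C1_on S q" using q' C1_on_continuous_on by (intro C1_onI[of S q q'])
  then have "C1_on S (\<lambda>x. 3 * max 0 (q x) ^ 2)"
    by (rule C1_on_compose_real[where h = "\<lambda>y. 3 * max 0 y ^ 2" and h' = "\<lambda>y. 6 * max 0 y"])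
      (use DERIV_cmult[OF has_real_derivative_max_power[of 0], of 3] in
        \<open>auto intro!: continuous_intros simp: power2_eq_square algebra_simps\<close>)
  then have "C1_on S (\<lambda>x. (3 * max 0 (q x) ^ 2) *\<^sub>R q' x)"
    by (rule C1_on_scaleR[OF _ C1q'])
  moreover have "(bump c r has_derivative blinfun_apply ((3 * max 0 (q x) ^ 2) *\<^sub>R q' x)) (at x within S)" for x
  proof -
    have "((\<lambda>y. max 0 y ^ 3) has_real_derivative 3 * max 0 y ^ 2) (at y)" for y :: real
      using has_real_derivative_max_power[of 1 y] by (simp add: numeral_eq_Suc)
    from has_derivative_compose[OF q' this[unfolded has_field_derivative_def]]
    show ?thesis unfolding q_def bump_def[abs_def] by (simp add: blinfun.scaleR_left[abs_def])
  qed
  ultimately show ?thesis by (intro C2_onI)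
qed

lemma bump_nonneg: "bump c r x \<ge> 0"
  by (simp add: bump_def)

lemma bump_pos: "x \<in> ball c r \<Longrightarrow> bump c r x > 0"
  by (auto simp: bump_def dist_norm norm_minus_commute less_max_iff_disj intro!: power_strict_mono)

lemma bump_eq_0: "r > 0 \<Longrightarrow> x \<notin> ball c r \<Longrightarrow> bump c r x = 0"
  using power_mono[of r "norm (x - c)" 2]
  by (simp add: bump_def dist_norm norm_minus_commute)

text \<open>The complement of the closed ball is open and the bump vanishes on it, so locality
  applies.\<close>

lemma pderiv_at_bump_eq_0:
  assumes "r > 0" "x \<notin> cball c r"
  shows "pderiv_at j (bump c r) x = 0"
proof -
  have "pderiv_at j (bump c r) x = pderiv_at j (\<lambda>x. 0) x"
    by (rule pderiv_at_cong[of "- cball c r"]) (use assms bump_eq_0[OF assms(1), of _ c] in auto)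
  then show ?thesis by (simp add: pderiv_at_def vector_derivative_const_at)
qed

section \<open>Integration against compactly supported functions\<close>

text \<open>A continuous function on \<open>S\<close> may blow up towards the boundary. Vanishing
  off \<open>K\<close> reduces the claim to a continuous function on a compact set.\<close>

lemma set_integrable_compact_support:
  fixes f :: "'a::euclidean_space \<Rightarrow> real"
  assumes "compact K" "K \<subseteq> S" "continuous_on S f" "\<And>x. x \<in> S - K \<Longrightarrow> f x = 0"
  shows "set_integrable lborel S f"
proof -
  have "(\<lambda>x. indicator S x *\<^sub>R f x) = (\<lambda>x. indicator K x *\<^sub>R f x)"
    by (rule ext) (use assms(2,4) in \<open>auto simp: indicator_def\<close>)
  then show ?thesis
    using borel_integrable_compact[OF assms(1) continuous_on_subset[OF assms(3,2)]]
    by (simp add: set_integrable_def)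
qed

lemma set_integral_sum:
  fixes f :: "'i \<Rightarrow> 'a \<Rightarrow> 'b::{banach, second_countable_topology}"
  assumes "\<And>i. i \<in> A \<Longrightarrow> set_integrable M S (f i)"
  shows "set_integrable M S (\<lambda>x. \<Sum>i\<in>A. f i x)"
    and "(LINT x:S|M. (\<Sum>i\<in>A. f i x)) = (\<Sum>i\<in>A. LINT x:S|M. f i x)"
  using assms unfolding set_integrable_def set_lebesgue_integral_def scaleR_sum_right
  by (auto intro!: Bochner_Integration.integrable_sum Bochner_Integration.integral_sum)

text \<open>
  The difference quotients of \<open>F\<close> integrate to zero because Lebesgue measure is translation
  invariant, and they converge dominatedly to the derivative; no Fubini argument is needed.
\<close>

lemma integral_directional_derivative_eq_0:
  fixes F F' :: "'a::euclidean_space \<Rightarrow> real"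
  assumes deriv: "\<And>x. ((\<lambda>s. F (x + s *\<^sub>R e)) has_vector_derivative F' x) (at 0)"
    and contF: "continuous_on UNIV F" and contF': "continuous_on UNIV F'"
    and K: "compact K" "\<And>x. x \<notin> K \<Longrightarrow> F x = 0" "\<And>x. x \<notin> K \<Longrightarrow> F' x = 0"
  shows "integral\<^sup>L lborel F' = 0"
proof -
  have "bounded (F' ` K)"
    using K contF' by (metis compact_continuous_image compact_imp_bounded continuous_on_subset top_greatest)
  then obtain M where M: "M > 0" "\<And>x. x \<in> K \<Longrightarrow> norm (F' x) \<le> M"
    by (auto simp: bounded_pos)
  then have M': "norm (F' x) \<le> M" for x using K(3)[of x] by (cases "x \<in> K") auto
  \<comment> \<open>The mean value inequality bounds all difference quotients by the same
    \<open>M\<close>, which supplies the height of the dominating function.\<close>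
  have lip: "\<bar>F (x + s *\<^sub>R e) - F x\<bar> \<le> M * \<bar>s\<bar>" for x s
  proof -
    have "((\<lambda>s. F (x + s *\<^sub>R e)) has_derivative (\<lambda>h. h *\<^sub>R F' (x + t *\<^sub>R e))) (at t)" for t
    proof -
      have sh: "((\<lambda>s. s - t) has_vector_derivative 1) (at t)"
        unfolding has_real_derivative_iff_has_vector_derivative[symmetric]
        by (auto intro!: derivative_eq_intros)
      have "((\<lambda>s. F ((x + t *\<^sub>R e) + (s - t) *\<^sub>R e)) has_vector_derivative 1 *\<^sub>R F' (x + t *\<^sub>R e)) (at t)"
        using vector_diff_chain_at[of "\<lambda>s. s - t" 1 t "\<lambda>s. F ((x + t *\<^sub>R e) + s *\<^sub>R e)" "F' (x + t *\<^sub>R e)"]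
          deriv[of "x + t *\<^sub>R e"]
          sh by (simp add: o_def)
      then show ?thesis by (simp add: has_vector_derivative_def algebra_simps)
    qed
    moreover have "onorm (\<lambda>h. h *\<^sub>R F' (x + t *\<^sub>R e)) \<le> M" for t
      using M M'[of "x + t *\<^sub>R e"] by (intro onorm_le) (simp add: abs_mult mult_left_mono mult.commute[of M])
    ultimately have "norm (F (x + s *\<^sub>R e) - F (x + 0 *\<^sub>R e)) \<le> M * norm (s - 0)"
      by (intro differentiable_bound[where S = UNIV and f' = "\<lambda>t h. h *\<^sub>R F' (x + t *\<^sub>R e)"]) auto
    then show ?thesis by simp
  qed
  \<comment> \<open>\<open>L\<close> consists of all points that a shift by
    \<open>s *\<^sub>R e\<close> with \<open>s\<close> in \<open>[0, 1]\<close> can carry into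
    \<open>K\<close>. It is compact and contains the supports of all difference quotients with steps
    in that range.\<close>
  define L where "L = (\<lambda>(y, z). y - z) ` (K \<times> closed_segment 0 e)"
  have L: "compact L" unfolding L_def
    by (intro compact_continuous_image compact_Times K compact_segment)
      (auto intro!: continuous_intros simp: case_prod_unfold)
  have outside: "F (x + s *\<^sub>R e) = 0" if "x \<notin> L" "0 \<le> s" "s \<le> 1" for x s
  proof (rule K(2), rule notI)
    assume "x + s *\<^sub>R e \<in> K"
    moreover have "s *\<^sub>R e \<in> closed_segment 0 e" using that by (auto simp: in_segment)
    ultimately have "(x + s *\<^sub>R e) - s *\<^sub>R e \<in> L" unfolding L_def by force
    then show False using that by simp
  qed
  have intF: "integrable lborel F"
    using set_integrable_compact_support[OF K(1) subset_UNIV contF] K(2) by (simp add: set_integrable_def)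
  have shift: "integrable lborel (\<lambda>x. F (x + y))" "integral\<^sup>L lborel (\<lambda>x. F (x + y)) = integral\<^sup>L lborel F" for y
  proof -
    have m: "F \<in> borel_measurable borel" using contF by (rule borel_measurable_continuous_onI)
    have "integrable (distr lborel borel ((+) y)) F" using intF by (simp add: lborel_distr_plus)
    then show "integrable lborel (\<lambda>x. F (x + y))"
      by (subst (asm) integrable_distr_eq) (auto simp: m add.commute)
    have "integral\<^sup>L (distr lborel borel ((+) y)) F = integral\<^sup>L lborel F" by (simp add: lborel_distr_plus)
    then show "integral\<^sup>L lborel (\<lambda>x. F (x + y)) = integral\<^sup>L lborel F"
      by (subst (asm) integral_distr) (auto simp: m add.commute)
  qed
  \<comment> \<open>Positive steps of size at most 1 that tend to 0, so that \<open>outside\<close>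
    applies to every one of them.\<close>
  define s where "s n = inverse (real (Suc n))" for n
  have s: "0 < s n" "s n \<le> 1" for n by (auto simp: s_def field_simps)
  have "(\<lambda>n. integral\<^sup>L lborel (\<lambda>x. (F (x + s n *\<^sub>R e) - F x) / s n)) \<longlonglongrightarrow> integral\<^sup>L lborel F'"
  proof (rule integral_dominated_convergence[where w = "\<lambda>x. M * indicator L x"])
    show "F' \<in> borel_measurable lborel" using borel_measurable_continuous_onI[OF contF'] by simp
    show "(\<lambda>x. (F (x + s n *\<^sub>R e) - F x) / s n) \<in> borel_measurable lborel" for n
    proof -
      have "s n \<noteq> 0" using s[of n] by simp
      then show ?thesis
        by (auto intro!: borel_measurable_continuous_onI continuous_intros continuous_on_compose2[OF contF])
    qed
    show "integrable lborel (\<lambda>x. M * indicator L x)"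
      using L by (intro integrable_mult_right integrable_real_indicator)
        (use emeasure_bounded_finite[OF compact_imp_bounded[OF L]] in
          \<open>auto simp: compact_imp_closed infinity_ennreal_def\<close>)
    show "AE x in lborel. (\<lambda>n. (F (x + s n *\<^sub>R e) - F x) / s n) \<longlonglongrightarrow> F' x"
    proof (rule AE_I2)
      fix x
      have "((\<lambda>h. (F (x + h *\<^sub>R e) - F x) / h) \<longlongrightarrow> F' x) (at 0)"
        using deriv[of x] by (simp add: has_real_derivative_iff_has_vector_derivative[symmetric] DERIV_def)
      moreover have "filterlim s (at 0) sequentially"
        unfolding filterlim_at using s LIMSEQ_inverse_real_of_nat
        by (auto simp: s_def[abs_def] intro!: always_eventually)
      ultimately show "(\<lambda>n. (F (x + s n *\<^sub>R e) - F x) / s n) \<longlonglongrightarrow> F' x"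
        by (rule filterlim_compose)
    qed
    show "AE x in lborel. norm ((F (x + s n *\<^sub>R e) - F x) / s n) \<le> M * indicator L x" for n
    proof (rule AE_I2)
      fix x
      show "norm ((F (x + s n *\<^sub>R e) - F x) / s n) \<le> M * indicator L x"
        using lip[of x "s n"] s[of n] outside[of x "s n"] outside[of x 0]
        by (cases "x \<in> L") (auto simp: field_simps)
    qed
  qed
  moreover have "integral\<^sup>L lborel (\<lambda>x. (F (x + s n *\<^sub>R e) - F x) / s n) = 0" for n
    using shift intF by simp
  ultimately have "(\<lambda>n. 0) \<longlonglongrightarrow> integral\<^sup>L lborel F'" by (simp only:)
  then show ?thesis by (simp add: LIMSEQ_const_iff)
qed

section \<open>Vanishing of the first variation\<close>

text \<open>Near 0 the linear term dominates the quadratic one, so a nonzero \<open>b\<close> would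
  produce a negative value on one side.\<close>

lemma linear_coefficient_eq_0:
  fixes b c :: real
  assumes "\<And>s. 0 \<le> 2 * s * b + s\<^sup>2 * c"
  shows "b = 0"
proof (rule ccontr)
  assume "b \<noteq> 0"
  define k where "k = \<bar>c\<bar> + 1"
    \<comment> \<open>the quadratic is negative at \<open>s = - b / k\<close>\<close>
  have k: "k > 0" "c < k" by (auto simp: k_def)
  have "2 * (- b / k) * b + (- b / k)\<^sup>2 * c = (b\<^sup>2 / k) * (c / k - 2)"
    using k(1) by (simp add: power2_eq_square field_simps)
  moreover have "(b\<^sup>2 / k) * (c / k - 2) < 0"
    using k \<open>b \<noteq> 0\<close> by (intro mult_pos_neg) (auto simp: field_simps)
  ultimately show False using assms[of "- b / k"] by simp
qed

text \<open>\<open>B\<close> and \<open>C\<close> are integrable by compact support,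
  \<open>g\<close> only by finiteness of the energy. All integrals are then real numbers, the
  integral of \<open>g\<close> cancels from the minimality inequality, and a quadratic polynomial in
  \<open>s\<close> without constant term remains.\<close>

lemma first_variation_eq_0:
  fixes g B C :: "'a::euclidean_space \<Rightarrow> real"
  assumes "open \<Omega>" "compact K" "K \<subseteq> \<Omega>"
    and cont: "continuous_on \<Omega> g" "continuous_on \<Omega> B" "continuous_on \<Omega> C"
    and supp: "\<And>x. x \<in> \<Omega> - K \<Longrightarrow> B x = 0" "\<And>x. x \<in> \<Omega> - K \<Longrightarrow> C x = 0"
    and nonneg: "\<And>s x. x \<in> \<Omega> \<Longrightarrow> 0 \<le> g x + 2 * s * B x + s\<^sup>2 * C x"
    and fin: "(\<integral>\<^sup>+x\<in>\<Omega>. ennreal (g x) \<partial>lborel) < \<infinity>"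
    and min: "\<And>s. (\<integral>\<^sup>+x\<in>\<Omega>. ennreal (g x) \<partial>lborel)
      \<le> (\<integral>\<^sup>+x\<in>\<Omega>. ennreal (g x + 2 * s * B x + s\<^sup>2 * C x) \<partial>lborel)"
  shows "(LINT x:\<Omega>|lborel. B x) = 0"
proof -
  have meas: "(\<lambda>x. indicator \<Omega> x *\<^sub>R f x) \<in> borel_measurable lborel" if "continuous_on \<Omega> f" for f :: "'a \<Rightarrow> real"
    using borel_measurable_continuous_on_indicator[OF _ that] assms(1) by simp
  have eq: "(\<integral>\<^sup>+x\<in>\<Omega>. ennreal (f x) \<partial>lborel) = (\<integral>\<^sup>+x. ennreal (indicator \<Omega> x *\<^sub>R f x) \<partial>lborel)" for f :: "'a \<Rightarrow> real"
    by (intro nn_integral_cong) (auto simp: indicator_def)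
  \<comment> \<open>The case \<open>s = 0\<close> of \<open>nonneg\<close> gives the sign of
    \<open>g\<close>; with it, the finite nonnegative integral implies integrability.\<close>
  have intg: "set_integrable lborel \<Omega> g"
    unfolding set_integrable_def
  proof (rule integrableI_nonneg)
    show "AE x in lborel. 0 \<le> indicator \<Omega> x *\<^sub>R g x"
      using nonneg[of _ 0] by (intro AE_I2) (auto simp: indicator_def)
  qed (use fin in \<open>simp_all add: eq meas[OF cont(1), simplified]\<close>)
  have int: "set_integrable lborel \<Omega> f" if "continuous_on \<Omega> f" "\<And>x. x \<in> \<Omega> - K \<Longrightarrow> f x = 0" for f :: "'a \<Rightarrow> real"
    by (rule set_integrable_compact_support[OF assms(2,3) that])
  have val: "(\<integral>\<^sup>+x\<in>\<Omega>. ennreal (g x + 2 * s * B x + s\<^sup>2 * C x) \<partial>lborel) =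
    ennreal ((LINT x:\<Omega>|lborel. g x) + 2 * s * (LINT x:\<Omega>|lborel. B x) + s\<^sup>2 * (LINT x:\<Omega>|lborel. C x))"
    and val_nonneg: "0 \<le> (LINT x:\<Omega>|lborel. g x) + 2 * s * (LINT x:\<Omega>|lborel. B x) + s\<^sup>2 * (LINT x:\<Omega>|lborel. C x)" for s
  proof -
    have i: "set_integrable lborel \<Omega> (\<lambda>x. g x + 2 * s * B x + s\<^sup>2 * C x)"
      by (intro set_integral_add set_integrable_mult_right intg int cont supp)
    have e: "(LINT x:\<Omega>|lborel. g x + 2 * s * B x + s\<^sup>2 * C x) =
      (LINT x:\<Omega>|lborel. g x) + 2 * s * (LINT x:\<Omega>|lborel. B x) + s\<^sup>2 * (LINT x:\<Omega>|lborel. C x)"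
    proof -
      have B: "set_integrable lborel \<Omega> (\<lambda>x. 2 * s * B x)" and C: "set_integrable lborel \<Omega> (\<lambda>x. s\<^sup>2 * C x)"
        by (intro set_integrable_mult_right int cont supp; assumption)+
      show ?thesis
        using set_integral_add(2)[OF set_integral_add(1)[OF intg B] C] set_integral_add(2)[OF intg B] by simp
    qed
    show "(\<integral>\<^sup>+x\<in>\<Omega>. ennreal (g x + 2 * s * B x + s\<^sup>2 * C x) \<partial>lborel) =
    ennreal ((LINT x:\<Omega>|lborel. g x) + 2 * s * (LINT x:\<Omega>|lborel. B x) + s\<^sup>2 * (LINT x:\<Omega>|lborel. C x))"
      unfolding eq e[symmetric] unfolding set_lebesgue_integral_def
      using i nonneg unfolding set_integrable_def
      by (intro nn_integral_eq_integral) (auto simp: indicator_def)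
    show "0 \<le> (LINT x:\<Omega>|lborel. g x) + 2 * s * (LINT x:\<Omega>|lborel. B x) + s\<^sup>2 * (LINT x:\<Omega>|lborel. C x)"
      unfolding e[symmetric] unfolding set_lebesgue_integral_def
      using nonneg by (intro integral_nonneg_AE AE_I2) (auto simp: indicator_def)
  qed
  show ?thesis
  proof (rule linear_coefficient_eq_0)
    fix s
    \<comment> \<open>The instance \<open>s = 0\<close> of \<open>val\<close> expresses the
      unperturbed energy as a real number, so that the comparison in \<open>ennreal\<close> becomes
      one in the reals.\<close>
    show "0 \<le> 2 * s * (LINT x:\<Omega>|lborel. B x) + s\<^sup>2 * (LINT x:\<Omega>|lborel. C x)"
      using min[of s] val[of s] val[of 0] val_nonneg[of s] by (simp add: ennreal_le_iff)
  qed
qed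

text \<open>Passes from the nonnegative integral in \<open>energy\<close> to the gauge integral, for
  which the fundamental theorem of calculus and continuity in parameters are used.\<close>

lemma set_nn_integral_continuous_Icc:
  fixes g :: "real \<Rightarrow> real"
  assumes "continuous_on {a..b} g" "\<And>t. t \<in> {a..b} \<Longrightarrow> 0 \<le> g t"
  shows "(\<integral>\<^sup>+t\<in>{a..b}. ennreal (g t) \<partial>lborel) = ennreal (integral {a..b} g)"
proof -
  have i: "set_integrable lborel {a..b} g"
    by (rule borel_integrable_atLeastAtMost'[OF assms(1)])
  have "(\<integral>\<^sup>+t\<in>{a..b}. ennreal (g t) \<partial>lborel) = (\<integral>\<^sup>+t. ennreal (indicator {a..b} t *\<^sub>R g t) \<partial>lborel)"
    by (intro nn_integral_cong) (auto simp: indicator_def)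
  also have "\<dots> = ennreal (LINT t:{a..b}|lborel. g t)"
    unfolding set_lebesgue_integral_def using i assms(2) unfolding set_integrable_def
    by (intro nn_integral_eq_integral) (auto simp: indicator_def)
  finally show ?thesis by (simp add: set_borel_integral_eq_integral[OF i])
qed

section \<open>The fundamental lemma of the calculus of variations\<close>

text \<open>If \<open>R x\<close> were positive, \<open>R\<close> would be positive on a small
  closed ball. The product with the bump is then nonnegative with integral 0, hence zero almost
  everywhere, yet it is positive on an open ball of positive measure.\<close>

lemma bump_test_nonpos:
  fixes R :: "'a::euclidean_space \<Rightarrow> real"
  assumes "open \<Omega>" "continuous_on \<Omega> R" "x \<in> \<Omega>"
    and test: "\<And>r. r > 0 \<Longrightarrow> cball x r \<subseteq> \<Omega> \<Longrightarrow> (LINT y:\<Omega>|lborel. bump x r y * R y) = 0"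
  shows "R x \<le> 0"
proof (rule ccontr)
  assume "\<not> R x \<le> 0"
  have "open (R -` {0<..} \<inter> \<Omega>)"
    using assms(1,2) by (simp add: continuous_on_open_vimage)
  then obtain r where r: "r > 0" "cball x r \<subseteq> R -` {0<..} \<inter> \<Omega>"
    using \<open>\<not> R x \<le> 0\<close> assms(3) by (metis IntI greaterThan_iff linorder_not_le open_contains_cball vimage_eq)
  let ?f = "\<lambda>y. indicator \<Omega> y *\<^sub>R (bump x r y * R y)"
  \<comment> \<open>Inside the closed ball both factors are nonnegative; outside it the bump
    vanishes, whatever the sign of \<open>R\<close>.\<close>
  have nonneg: "0 \<le> ?f y" for y
    using r bump_nonneg[of x r y] bump_eq_0[OF r(1), of y x]
    by (cases "y \<in> cball x r") (auto simp: indicator_def subset_eq less_imp_le)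
  have "integrable lborel ?f"
    unfolding set_integrable_def[symmetric]
    using r(2) bump_eq_0[OF r(1), of _ x]
    by (intro set_integrable_compact_support[of "cball x r"] continuous_intros assms(2)
        C1_on_continuous_on C2_on_C1_on C2_on_bump) auto
  moreover have "integral\<^sup>L lborel ?f = 0"
    using test[OF r(1)] r(2) by (auto simp: set_lebesgue_integral_def)
  ultimately have "AE y in lborel. ?f y = 0"
    using nonneg by (subst (asm) integral_nonneg_eq_0_iff_AE) auto
  then have "AE y in lborel. y \<notin> ball x r"
  proof (rule AE_mp, intro AE_I2 impI notI)
    fix y assume "?f y = 0" "y \<in> ball x r"
    moreover have "y \<in> \<Omega>" "R y > 0" using r \<open>y \<in> ball x r\<close> ball_subset_cball by blast+
    ultimately show False using bump_pos[of y x r] by simp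
  qed
  then have "emeasure lborel (ball x r) = 0"
    by (subst (asm) AE_iff_measurable[of "ball x r"]) auto
  then show False using r(1)
    by (simp add: emeasure_ball unit_ball_vol_pos[THEN less_imp_neq, symmetric])
qed

lemma bump_test_eq_0:
  fixes R :: "'a::euclidean_space \<Rightarrow> real"
  assumes "open \<Omega>" "continuous_on \<Omega> R" "x \<in> \<Omega>"
    and test: "\<And>r. r > 0 \<Longrightarrow> cball x r \<subseteq> \<Omega> \<Longrightarrow> (LINT y:\<Omega>|lborel. bump x r y * R y) = 0"
  shows "R x = 0"
proof -
  have "- R x \<le> 0"
    by (rule bump_test_nonpos[of \<Omega> "\<lambda>y. - R y"])
      (use assms in \<open>auto intro!: continuous_intros simp: set_lebesgue_integral_def\<close>)
  then show ?thesis using bump_test_nonpos[OF assms] by simp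
qed

text \<open>The integrand is the partial derivative of the product of the bump and \<open>f\<close>.
  That product extends by zero to a compactly supported continuously differentiable function on the
  whole space, so no boundary term arises.\<close>

lemma integral_bump_by_parts:
  fixes f :: "real^'n::finite \<Rightarrow> real"
  assumes "open \<Omega>" "C1_on \<Omega> f" "r > 0" "cball c r \<subseteq> \<Omega>"
  shows "(LINT x:\<Omega>|lborel. pderiv_at j (bump c r) x * f x + bump c r x * pderiv_at j f x) = 0"
proof -
  let ?F = "\<lambda>x. bump c r x * f x"
  let ?F' = "\<lambda>x. indicator \<Omega> x *\<^sub>R (pderiv_at j (bump c r) x * f x + bump c r x * pderiv_at j f x)"
  \<comment> \<open>Continuity is proved on each of these two open sets and glued: on \<Omega> by
    the regularity of \<open>f\<close>, off the closed ball because everything vanishes.\<close>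
  have U: "\<Omega> \<union> (- cball c r) = UNIV" using assms(4) by auto
  have C1b: "C1_on S (bump c r)" for S by (intro C2_on_C1_on C2_on_bump)
  have zero: "bump c r x = 0" if "x \<in> - cball c r" for x
    using that bump_eq_0[OF assms(3), of x c] by auto
  have zero': "pderiv_at j (bump c r) x = 0" if "x \<in> - cball c r" for x
    using that by (simp add: pderiv_at_bump_eq_0[OF assms(3)])
  have F0: "?F x = 0" "?F' x = 0" if "x \<in> - cball c r" for x
    using zero[OF that] zero'[OF that] by auto
  have "integral\<^sup>L lborel ?F' = 0"
  proof (rule integral_directional_derivative_eq_0[where F = ?F and e = "axis j 1" and K = "cball c r"])
    show "continuous_on UNIV ?F"
      unfolding U[symmetric]
      by (rule continuous_on_open_Un[OF assms(1)])
        (auto intro!: continuous_on_mult[OF C1_on_continuous_on[OF C1b] C1_on_continuous_on[OF assms(2)]]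
          continuous_on_eq[of "- cball c r" "\<lambda>x. 0" ?F] simp: F0)
    have *: "continuous_on \<Omega> ?F'"
      by (rule continuous_on_eq[of _ "\<lambda>x. pderiv_at j (bump c r) x * f x + bump c r x * pderiv_at j f x"])
        (auto intro!: continuous_on_add continuous_on_mult C1_on_pderiv_at(2)[OF assms(1)] C1b assms(2)
          C1_on_continuous_on[OF C1b] C1_on_continuous_on[OF assms(2)])
    have "continuous_on (- cball c r) ?F'"
      by (rule continuous_on_eq[OF continuous_on_const[of _ 0]]) (rule F0(2)[symmetric])
    then show "continuous_on UNIV ?F'"
      using * unfolding U[symmetric]
      by (intro continuous_on_open_Un assms(1)) auto
    show "((\<lambda>s. bump c r (x + s *\<^sub>R axis j 1) * f (x + s *\<^sub>R axis j 1)) has_vector_derivative ?F' x) (at 0)" for x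
    proof (cases "x \<in> \<Omega>")
      case True
      then show ?thesis
        using has_vector_derivative_mult[OF C1_on_pderiv_at(1)[OF assms(1) C1b True, where j = j]
            C1_on_pderiv_at(1)[OF assms(1,2) True, where j = j]]
        by (simp add: algebra_simps)
    next
      \<comment> \<open>Nothing is known about \<open>f\<close> here, but the bump is zero near
        \<open>x\<close>, so the product agrees with 0 along the line close to
        \<open>x\<close>.\<close>
      case False
      then have x: "x \<in> - cball c r" using assms(4) by auto
      have "((\<lambda>s::real. 0) has_vector_derivative ?F' x) (at 0)"
        unfolding F0(2)[OF x] by simp
      then show ?thesis
        using has_vector_derivative_line_cong[OF _ x, of ?F "\<lambda>x. 0"] F0(1) by auto
    qed
  qed (use F0 in auto)
  then show ?thesis by (simp add: set_lebesgue_integral_def)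
qed

section \<open>The energy of time-harmonic fields\<close>

definition hvec :: "real \<Rightarrow> real \<Rightarrow> complex^'n::finite \<Rightarrow> real^'n" where
  "hvec \<omega> t z = (\<chi> k. Re (z $ k * exp (\<i> * complex_of_real (t * \<omega>))))"

text \<open>Acting row by row makes this the Jacobian of a harmonic field when applied to the
  complex Jacobian \<open>cjac\<close> of its amplitude.\<close>

definition hmat :: "real \<Rightarrow> real \<Rightarrow> complex^'n::finite^'m::finite \<Rightarrow> real^'n^'m" where
  "hmat \<omega> t M = (\<chi> k. hvec \<omega> t (M $ k))"

definition cjac :: "(real^'n::finite \<Rightarrow> complex^'m::finite) \<Rightarrow> real^'n \<Rightarrow> complex^'n^'m" where
  "cjac a x = (\<chi> k j. pderiv_at j (\<lambda>y. a y $ k) x)"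

lemma hvec_add: "hvec \<omega> t (y + z) = hvec \<omega> t y + hvec \<omega> t z"
  by (simp add: hvec_def vec_eq_iff algebra_simps)

lemma hvec_scaleR: "hvec \<omega> t (r *\<^sub>R z) = r *\<^sub>R hvec \<omega> t z"
  by (simp add: hvec_def vec_eq_iff algebra_simps)

lemma hmat_add: "hmat \<omega> t (y + z) = hmat \<omega> t y + hmat \<omega> t z"
  by (simp add: hmat_def vec_eq_iff hvec_add)

lemma hmat_scaleR: "hmat \<omega> t (r *\<^sub>R z) = r *\<^sub>R hmat \<omega> t z"
  by (simp add: hmat_def vec_eq_iff hvec_scaleR)

text \<open>For the real inner product on complex numbers, the adjoint of multiplication by a number
  is multiplication by its conjugate. Moving the exponential across creates the Fourier kernel at
  \<omega>.\<close>

lemma inner_hvec: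
  "g \<bullet> hvec \<omega> t c = c \<bullet> (\<chi> k. complex_of_real (g $ k) * cnj (exp (\<i> * complex_of_real (t * \<omega>))))"
  by (simp add: inner_vec_def hvec_def inner_complex_def algebra_simps)

lemma continuous_on_hvec [continuous_intros]:
  assumes "continuous_on S f" "continuous_on S g"
  shows "continuous_on S (\<lambda>y. hvec \<omega> (f y) (g y))"
  unfolding hvec_def using assms by (intro continuous_intros)

lemma continuous_on_hmat [continuous_intros]:
  assumes "continuous_on S f" "continuous_on S g"
  shows "continuous_on S (\<lambda>y. hmat \<omega> (f y) (g y))"
  unfolding hmat_def using assms by (intro continuous_intros)

text \<open>The product of the two real parts is half the constant \<open>w \<bullet> z\<close> plus
  half an oscillation of frequency \<open>2 * \<omega>\<close>. The oscillation integrates to 0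
  because \<open>T\<close> is a multiple of its period.\<close>

lemma has_integral_harmonic_mult:
  assumes "T = 2 * pi * real p / \<omega>" "T > 0"
  shows "((\<lambda>t. Re (w * exp (\<i> * complex_of_real (t * \<omega>))) * Re (z * exp (\<i> * complex_of_real (t * \<omega>))))
    has_integral (T / 2) * (w \<bullet> z)) {0..T}"
proof -
  let ?e = "\<lambda>t. exp (\<i> * complex_of_real (t * \<omega>))"
  \<comment> \<open>Division by zero yields 0 in HOL, so \<omega> = 0 would contradict the
    positivity of \<open>T\<close>.\<close>
  have om: "\<omega> \<noteq> 0" using assms by auto
  \<comment> \<open>The real part of \<open>G\<close> is an antiderivative: a linear term for the
    mean and an exponential for the oscillation.\<close>
  define G where "G t = (t / 2) *\<^sub>R complex_of_real (w \<bullet> z) + w * z * exp (2 * \<i> * \<omega> * of_real t) / (4 * \<i> * \<omega>)" for t :: real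
  have "((\<lambda>t. Re (G t)) has_vector_derivative Re (w * ?e t) * Re (z * ?e t)) (at t within {0..T})" for t
  proof -
    have "(G has_vector_derivative (complex_of_real (w \<bullet> z) / 2 + w * z * exp (2 * \<i> * \<omega> * of_real t) / 2)) (at t within {0..T})"
      unfolding G_def using om
      by (auto intro!: derivative_eq_intros has_vector_derivative_real_field simp: scaleR_conv_of_real)
    from bounded_linear.has_vector_derivative[OF bounded_linear_Re this]
    have "((\<lambda>t. Re (G t)) has_vector_derivative ((w \<bullet> z) / 2 + Re (w * z * exp (2 * \<i> * \<omega> * of_real t)) / 2)) (at t within {0..T})"
      by simp
    moreover have "(w \<bullet> z) / 2 + Re (w * z * exp (2 * \<i> * \<omega> * of_real t)) / 2 = Re (w * ?e t) * Re (z * ?e t)"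
    proof -
      have e2: "exp (2 * \<i> * \<omega> * of_real t) = ?e t * ?e t"
        by (simp add: exp_add[symmetric] algebra_simps)
      have e1: "?e t * cnj (?e t) = 1"
        by (simp add: exp_cnj exp_add[symmetric])
      have "2 * (Re (w * ?e t) * Re (z * ?e t)) = Re ((w * ?e t) * (z * ?e t)) + Re ((w * ?e t) * cnj (z * ?e t))"
        by (simp add: algebra_simps)
      also have "(w * ?e t) * cnj (z * ?e t) = w * cnj z * (?e t * cnj (?e t))"
        by simp
      also have "(w * ?e t) * (z * ?e t) = w * z * (?e t * ?e t)"
        by (simp only: mult_ac)
      finally have "2 * (Re (w * ?e t) * Re (z * ?e t)) =
          Re (w * z * (?e t * ?e t)) + Re (w * cnj z * (?e t * cnj (?e t)))" .
      moreover have "Re (w * cnj z * (?e t * cnj (?e t))) = w \<bullet> z"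
        unfolding e1 by (simp add: inner_complex_def)
      ultimately show ?thesis unfolding e2 by linarith
    qed
    ultimately show ?thesis by simp
  qed
  then have "((\<lambda>t. Re (w * ?e t) * Re (z * ?e t)) has_integral (Re (G T) - Re (G 0))) {0..T}"
    using assms(2) by (intro fundamental_theorem_of_calculus) auto
  \<comment> \<open>At time \<open>T\<close> the phase \<open>2 * \<omega> * T\<close> equals
    \<open>2 * p\<close> full turns, so the oscillating part of \<open>G\<close> returns to its
    initial value.\<close>
  moreover have "exp (2 * \<i> * \<omega> * of_real T) = 1"
  proof -
    have "2 * \<i> * \<omega> * of_real T = 2 * of_real (real (2 * p)) * pi * \<i>"
    proof -
      have "2 * \<omega> * T = 2 * real (2 * p) * pi" using om assms(1) by (simp add: field_simps)
      then have "complex_of_real (2 * \<omega> * T) = complex_of_real (2 * real (2 * p) * pi)" by (simp only:)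
      then show ?thesis by simp
    qed
    then have "exp (2 * \<i> * \<omega> * of_real T) = exp (2 * of_real (real (2 * p)) * pi * \<i>)"
      by (simp only:)
    also have "\<dots> = 1" by (rule exp_integer_2pi) auto
    finally show ?thesis .
  qed
  ultimately show ?thesis by (simp add: G_def)
qed

lemma has_integral_inner_hvec:
  assumes "T = 2 * pi * real p / \<omega>" "T > 0"
  shows "((\<lambda>t. hvec \<omega> t y \<bullet> hvec \<omega> t z) has_integral (T / 2) * (y \<bullet> z)) {0..T}"
  unfolding inner_vec_def sum_distrib_left
  by (intro has_integral_sum) (use has_integral_harmonic_mult[OF assms] in \<open>auto simp: hvec_def\<close>)

lemma has_integral_inner_hmat:
  assumes "T = 2 * pi * real p / \<omega>" "T > 0"
  shows "((\<lambda>t. hmat \<omega> t y \<bullet> hmat \<omega> t z) has_integral (T / 2) * (y \<bullet> z)) {0..T}"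
proof -
  have "((\<lambda>t. \<Sum>k\<in>UNIV. hvec \<omega> t (y $ k) \<bullet> hvec \<omega> t (z $ k)) has_integral (\<Sum>k\<in>UNIV. (T / 2) * (y $ k \<bullet> z $ k))) {0..T}"
    by (intro has_integral_sum) (use has_integral_inner_hvec[OF assms] in auto)
  moreover have "hmat \<omega> t y \<bullet> hmat \<omega> t z = (\<Sum>k\<in>UNIV. hvec \<omega> t (y $ k) \<bullet> hvec \<omega> t (z $ k))" for t
    unfolding inner_vec_def[of "hmat \<omega> t y"] by (simp add: hmat_def)
  ultimately show ?thesis by (simp add: inner_vec_def[of y z] sum_distrib_left)
qed

section \<open>Expressing the energy through the amplitude\<close>

text \<open>Both are evaluations of the joint derivative of the image sequence, in the directions
  \<open>(1, 0)\<close> and \<open>(0, axis j 1)\<close>, and inherit its continuity.\<close>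

lemma continuous_on_dt_grad:
  fixes I :: "real \<Rightarrow> real^'n::finite \<Rightarrow> real"
  assumes "open \<Omega>" "T > 0" "C1_on ({0..T} \<times> \<Omega>) (\<lambda>(t, x). I t x)"
  shows "continuous_on ({0..T} \<times> \<Omega>) (\<lambda>(t, x). dt T I t x)"
    and "continuous_on ({0..T} \<times> \<Omega>) (\<lambda>(t, x). grad (I t) x)"
proof -
  let ?S = "{0..T} \<times> \<Omega>"
  obtain f' where f: "\<And>y. y \<in> ?S \<Longrightarrow> ((\<lambda>(t, x). I t x) has_derivative blinfun_apply (f' y)) (at y within ?S)"
    "continuous_on ?S f'" by (rule C1_onE[OF assms(3)]) blast
  have d: "dt T I t x = f' (t, x) (1, 0)" if tx: "t \<in> {0..T}" "x \<in> \<Omega>" for t x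
  proof -
    have "((\<lambda>s. (s, x)) has_derivative (\<lambda>h. (h, 0))) (at t within {0..T})"
      by (intro has_derivative_Pair has_derivative_ident has_derivative_const)
    moreover have "((\<lambda>(t, x). I t x) has_derivative blinfun_apply (f' (t, x))) (at (t, x) within (\<lambda>s. (s, x)) ` {0..T})"
      by (rule has_derivative_subset[OF f(1)]) (use tx in auto)
    ultimately have "((\<lambda>s. I s x) has_derivative (\<lambda>h. f' (t, x) (h, 0))) (at t within {0..T})"
      using has_derivative_in_compose[of "\<lambda>s. (s, x)" "\<lambda>h. (h, 0)" t "{0..T}" "\<lambda>(t, x). I t x" "f' (t, x)"] by simp
    moreover have "(\<lambda>h. f' (t, x) (h, 0)) = (\<lambda>h. h *\<^sub>R f' (t, x) (1, 0))"
    proof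
      fix h :: real
      show "f' (t, x) (h, 0) = h *\<^sub>R f' (t, x) (1, 0)"
        using blinfun.scaleR_right[of "f' (t, x)" h "(1, 0)"] by simp
    qed
    ultimately have "((\<lambda>s. I s x) has_vector_derivative f' (t, x) (1, 0)) (at t within {0..T})"
      by (simp only: has_vector_derivative_def)
    then show ?thesis
      \<comment> \<open>On a nondegenerate closed interval the derivative within it is unique, also
        at the end points where it is one-sided.\<close>
      unfolding dt_def by (rule vector_derivative_within_closed_interval[OF assms(2) tx(1)])
  qed
  have g: "grad (I t) x = (\<chi> j. f' (t, x) (0, axis j 1))" if tx: "t \<in> {0..T}" "x \<in> \<Omega>" for t x
  proof -
    have "((\<lambda>y. (t, y)) has_derivative (\<lambda>h. (0, h))) (at x within \<Omega>)"
      by (intro has_derivative_Pair has_derivative_ident has_derivative_const)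
    moreover have "((\<lambda>(t, x). I t x) has_derivative blinfun_apply (f' (t, x))) (at (t, x) within (\<lambda>y. (t, y)) ` \<Omega>)"
      by (rule has_derivative_subset[OF f(1)]) (use tx in auto)
    ultimately have "(I t has_derivative (\<lambda>h. f' (t, x) (0, h))) (at x within \<Omega>)"
      using has_derivative_in_compose[of "\<lambda>y. (t, y)" "\<lambda>h. (0, h)" x \<Omega> "\<lambda>(t, x). I t x" "f' (t, x)"] by simp
    then have "(I t has_derivative (\<lambda>h. f' (t, x) (0, h))) (at x)"
      using at_within_open[OF tx(2) assms(1)] by simp
    then show ?thesis unfolding grad_def by (simp add: pderiv_at_eq(1) vec_eq_iff)
  qed
  show "continuous_on ?S (\<lambda>(t, x). dt T I t x)"
    by (rule continuous_on_eq[of _ "\<lambda>y. f' y (1, 0)"]) (auto intro!: continuous_intros f(2) simp: d)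
  show "continuous_on ?S (\<lambda>(t, x). grad (I t) x)"
    by (rule continuous_on_eq[of _ "\<lambda>y. \<chi> j. f' y (0, axis j 1)"]) (auto intro!: continuous_intros f(2) simp: g)
qed

lemma C2_on_nth: "C2_on S a \<Longrightarrow> C2_on S (\<lambda>y. a y $ k)"
  by (rule C2_on_bounded_linear[OF bounded_linear_vec_nth])

lemma continuous_on_cjac:
  assumes "open S" "C2_on S a"
  shows "continuous_on S (cjac a)"
  unfolding cjac_def[abs_def]
  by (intro continuous_intros C1_on_pderiv_at(2)[OF assms(1)] C2_on_C1_on C2_on_nth assms(2))

text \<open>Multiplying by the exponential and taking the real part is real-linear, so it commutes
  with partial derivatives. Agreement is asked on \<Omega> only because an admissible field is
  arbitrary outside.\<close>

lemma jacobian_harmonic: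
  assumes "open \<Omega>" "C2_on \<Omega> a" "x \<in> \<Omega>" "\<And>y. y \<in> \<Omega> \<Longrightarrow> w y = hvec \<omega> t (a y)"
  shows "jacobian w x = hmat \<omega> t (cjac a x)"
proof -
  have "pderiv_at j (\<lambda>y. w y $ k) x = Re (pderiv_at j (\<lambda>y. a y $ k) x * exp (\<i> * complex_of_real (t * \<omega>)))" for j k
  proof -
    have "pderiv_at j (\<lambda>y. w y $ k) x = pderiv_at j (\<lambda>y. Re (a y $ k * exp (\<i> * complex_of_real (t * \<omega>)))) x"
      by (rule pderiv_at_cong[OF assms(1,3)]) (simp add: assms(4) hvec_def)
    also have "\<dots> = Re (pderiv_at j (\<lambda>y. a y $ k) x * exp (\<i> * complex_of_real (t * \<omega>)))"
      by (rule pderiv_at_bounded_linear[OF assms(1) C2_on_C1_on[OF C2_on_nth[OF assms(2)]] _ assms(3)])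
        (intro bounded_linear_compose[OF bounded_linear_Re] bounded_linear_mult_left)
    finally show ?thesis .
  qed
  then show ?thesis by (simp add: jacobian_def hmat_def hvec_def cjac_def vec_eq_iff)
qed

definition energy_density :: "real \<Rightarrow> real \<Rightarrow> real \<Rightarrow> (real \<Rightarrow> real^'n::finite \<Rightarrow> real) \<Rightarrow>
   (real^'n \<Rightarrow> complex^'n) \<Rightarrow> real \<Rightarrow> real^'n \<Rightarrow> real" where
  "energy_density T \<omega> lam I a t x =
     (grad (I t) x \<bullet> hvec \<omega> t (a x) + dt T I t x)\<^sup>2 + lam * (norm (hmat \<omega> t (cjac a x)))\<^sup>2"

lemma continuous_on_slice:
  assumes "continuous_on (A \<times> B) (\<lambda>(t, x). f t x)" "x \<in> B"
  shows "continuous_on A (\<lambda>t. f t x)"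
proof -
  have "continuous_on A (\<lambda>t. (\<lambda>(t, x). f t x) (t, x))"
    by (rule continuous_on_compose2[OF assms(1)]) (auto intro!: continuous_intros assms(2))
  then show ?thesis by simp
qed

lemma continuous_on_snd_Times:
  "continuous_on B f \<Longrightarrow> continuous_on (A \<times> B) (\<lambda>p. f (snd p))"
  by (rule continuous_on_compose2[of B f]) (auto intro!: continuous_intros)

lemma continuous_on_integral_param:
  fixes f :: "real \<Rightarrow> 'a::topological_space \<Rightarrow> 'b::euclidean_space"
  assumes "continuous_on ({a..b} \<times> B) (\<lambda>(t, x). f t x)"
  shows "continuous_on B (\<lambda>x. integral {a..b} (\<lambda>t. f t x))"
proof -
  have "continuous_on (B \<times> cbox a b) (\<lambda>p. (\<lambda>(t, x). f t x) (snd p, fst p))"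
    by (rule continuous_on_compose2[OF assms]) (auto intro!: continuous_intros)
  then have "continuous_on (B \<times> cbox a b) (\<lambda>(x, t). f t x)"
    by (simp add: case_prod_unfold)
  from integral_continuous_on_param[OF this] show ?thesis by simp
qed

text \<open>For fixed \<open>x\<close> in \<Omega> the integrand is continuous and nonnegative in
  time, so the inner integral is a real number. The outer one stays in \<open>ennreal\<close>, since
  a competitor may have infinite energy.\<close>

lemma energy_harmonic:
  fixes I :: "real \<Rightarrow> real^'n::finite \<Rightarrow> real"
  assumes "open \<Omega>" "T > 0" "lam > 0" "C1_on ({0..T} \<times> \<Omega>) (\<lambda>(t, x). I t x)"
    and "has_amplitude T \<Omega> \<omega> v a"
  shows "continuous_on ({0..T} \<times> \<Omega>) (\<lambda>(t, x). energy_density T \<omega> lam I a t x)"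
    and "energy T \<Omega> lam I v = (\<integral>\<^sup>+x\<in>\<Omega>. ennreal (integral {0..T} (\<lambda>t. energy_density T \<omega> lam I a t x)) \<partial>lborel)"
proof -
  have C2: "C2_on \<Omega> a" and v: "\<And>t x. t \<in> {0..T} \<Longrightarrow> x \<in> \<Omega> \<Longrightarrow> v t x = hvec \<omega> t (a x)"
    using assms(5) unfolding has_amplitude_def hvec_def by auto
  have "continuous_on ({0..T} \<times> \<Omega>) (\<lambda>p. a (snd p))" "continuous_on ({0..T} \<times> \<Omega>) (\<lambda>p. cjac a (snd p))"
    by (intro continuous_on_snd_Times continuous_on_cjac[OF assms(1) C2]
        C1_on_continuous_on[OF C2_on_C1_on[OF C2]])+
  then show cont: "continuous_on ({0..T} \<times> \<Omega>) (\<lambda>(t, x). energy_density T \<omega> lam I a t x)"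
    unfolding energy_density_def case_prod_unfold
    using continuous_on_dt_grad[OF assms(1,2,4)]
    by (intro continuous_intros) (simp_all add: case_prod_unfold)
  show "energy T \<Omega> lam I v = (\<integral>\<^sup>+x\<in>\<Omega>. ennreal (integral {0..T} (\<lambda>t. energy_density T \<omega> lam I a t x)) \<partial>lborel)"
    unfolding energy_def
  proof (intro nn_integral_cong)
    fix x
    have "(\<integral>\<^sup>+t\<in>{0..T}. ennreal (\<bar>grad (I t) x \<bullet> v t x + dt T I t x\<bar>\<^sup>2 + lam * (norm (jacobian (v t) x))\<^sup>2) \<partial>lborel)
      = ennreal (integral {0..T} (\<lambda>t. energy_density T \<omega> lam I a t x))" if x: "x \<in> \<Omega>"
    proof -
      have "(\<integral>\<^sup>+t\<in>{0..T}. ennreal (\<bar>grad (I t) x \<bullet> v t x + dt T I t x\<bar>\<^sup>2 + lam * (norm (jacobian (v t) x))\<^sup>2) \<partial>lborel)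
        = (\<integral>\<^sup>+t\<in>{0..T}. ennreal (energy_density T \<omega> lam I a t x) \<partial>lborel)"
        using v x jacobian_harmonic[OF assms(1) C2 x, of "v _" \<omega>]
        by (intro nn_integral_cong) (auto simp: indicator_def energy_density_def)
      also have "\<dots> = ennreal (integral {0..T} (\<lambda>t. energy_density T \<omega> lam I a t x))"
        by (rule set_nn_integral_continuous_Icc[OF continuous_on_slice[OF cont x]])
          (use assms(3) in \<open>simp add: energy_density_def\<close>)
      finally show ?thesis .
    qed
    then show "(\<integral>\<^sup>+t\<in>{0..T}. ennreal (\<bar>grad (I t) x \<bullet> v t x + dt T I t x\<bar>\<^sup>2 + lam * (norm (jacobian (v t) x))\<^sup>2) \<partial>lborel) * indicator \<Omega> x
      = ennreal (integral {0..T} (\<lambda>t. energy_density T \<omega> lam I a t x)) * indicator \<Omega> x"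
      by (auto simp: indicator_def)
  qed
qed

section \<open>The data term and its Fourier coefficients\<close>

text \<open>The Fourier coefficient at \<omega> of the residual times the image gradient, with the
  kernel in the conjugated form that \<open>inner_hvec\<close> produces.\<close>

definition data_term :: "real \<Rightarrow> real \<Rightarrow> (real \<Rightarrow> real^'n::finite \<Rightarrow> real) \<Rightarrow>
   (real^'n \<Rightarrow> complex^'n) \<Rightarrow> real^'n \<Rightarrow> complex^'n" where
  "data_term T \<omega> I a x = integral {0..T} (\<lambda>t. (grad (I t) x \<bullet> hvec \<omega> t (a x) + dt T I t x) *\<^sub>R
     (\<chi> k. complex_of_real (grad (I t) x $ k) * cnj (exp (\<i> * complex_of_real (t * \<omega>)))))"

lemma continuous_on_data_term_integrand:
  fixes I :: "real \<Rightarrow> real^'n::finite \<Rightarrow> real"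
  assumes "open \<Omega>" "T > 0" "C1_on ({0..T} \<times> \<Omega>) (\<lambda>(t, x). I t x)" "continuous_on \<Omega> a"
  shows "continuous_on ({0..T} \<times> \<Omega>) (\<lambda>(t, x). (grad (I t) x \<bullet> hvec \<omega> t (a x) + dt T I t x) *\<^sub>R
     (\<chi> k. complex_of_real (grad (I t) x $ k) * cnj (exp (\<i> * complex_of_real (t * \<omega>)))))"
proof -
  have "continuous_on ({0..T} \<times> \<Omega>) (\<lambda>p. a (snd p))"
    by (rule continuous_on_snd_Times[OF assms(4)])
  then show ?thesis
    using continuous_on_dt_grad[OF assms(1-3)]
    unfolding case_prod_unfold by (intro continuous_intros) simp_all
qed

lemma fourier_eq_integral:
  assumes "continuous_on {0..T} (\<lambda>t. f t x)"
  shows "fourier T f \<nu> x = integral {0..T} (\<lambda>t. complex_of_real (f t x) * exp (- (\<i> * complex_of_real (t * \<nu>))))"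
    and "(\<lambda>t. complex_of_real (f t x) * exp (- (\<i> * complex_of_real (t * \<nu>)))) integrable_on {0..T}"
proof -
  have "continuous_on {0..T} (\<lambda>t. complex_of_real (f t x) * exp (- (\<i> * complex_of_real (t * \<nu>))))"
    by (intro continuous_intros assms)
  from borel_integrable_atLeastAtMost'[OF this]
  show "fourier T f \<nu> x = integral {0..T} (\<lambda>t. complex_of_real (f t x) * exp (- (\<i> * complex_of_real (t * \<nu>))))"
    and "(\<lambda>t. complex_of_real (f t x) * exp (- (\<i> * complex_of_real (t * \<nu>)))) integrable_on {0..T}"
    unfolding fourier_def by (auto intro: set_borel_integral_eq_integral)
qed

text \<open>Twice the field is \<open>a\<close> times the exponential plus the conjugate of this
  product. The kernel at \<omega> turns the first part into frequency 0 acting on \<open>a\<close>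
  and the second into frequency \<open>2 * \<omega>\<close> acting on the conjugate.\<close>

lemma data_term_eq_fourier:
  fixes I :: "real \<Rightarrow> real^'n::finite \<Rightarrow> real"
  assumes "open \<Omega>" "T > 0" "C1_on ({0..T} \<times> \<Omega>) (\<lambda>(t, x). I t x)" "continuous_on \<Omega> a" "x \<in> \<Omega>"
  shows "2 *\<^sub>R data_term T \<omega> I a x =
      fourier_mat T (\<lambda>t y. outer (grad (I t) y) (grad (I t) y)) (2 * \<omega>) x *v cnj_vec (a x)
    + fourier_mat T (\<lambda>t y. outer (grad (I t) y) (grad (I t) y)) 0 x *v a x
    + 2 *\<^sub>R fourier_vec T (\<lambda>t y. dt T I t y *\<^sub>R grad (I t) y) \<omega> x"
proof -
  let ?e = "\<lambda>t. exp (\<i> * complex_of_real (t * \<omega>))"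
  define G where "G k t = grad (I t) x $ k" for k t
  define H where "H t = dt T I t x" for t
  have "continuous_on {0..T} (\<lambda>t. grad (I t) x)" and cH: "continuous_on {0..T} H"
    using continuous_on_dt_grad[OF assms(1-3), THEN continuous_on_slice, OF assms(5)]
    by (auto simp: H_def[abs_def])
  then have cG: "continuous_on {0..T} (G k)" for k
    unfolding G_def[abs_def] by (intro continuous_intros)
  have "2 * data_term T \<omega> I a x $ k =
      (\<Sum>l\<in>UNIV. fourier T (\<lambda>t y. grad (I t) y $ k * grad (I t) y $ l) (2 * \<omega>) x * cnj (a x $ l))
    + (\<Sum>l\<in>UNIV. fourier T (\<lambda>t y. grad (I t) y $ k * grad (I t) y $ l) 0 x * a x $ l)
    + 2 * fourier T (\<lambda>t y. dt T I t y * grad (I t) y $ k) \<omega> x" for k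
  proof -
    have int: "((\<lambda>t. complex_of_real (G k t * G l t) * exp (- (\<i> * complex_of_real (t * \<nu>)))) has_integral
        fourier T (\<lambda>t y. grad (I t) y $ k * grad (I t) y $ l) \<nu> x) {0..T}" for l \<nu>
      using fourier_eq_integral[where f = "\<lambda>t y. grad (I t) y $ k * grad (I t) y $ l" and x = x and T = T and \<nu> = \<nu>] cG
      by (auto simp: G_def[abs_def] has_integral_integral continuous_on_mult)
    have int': "((\<lambda>t. complex_of_real (H t * G k t) * exp (- (\<i> * complex_of_real (t * \<omega>)))) has_integral
        fourier T (\<lambda>t y. dt T I t y * grad (I t) y $ k) \<omega> x) {0..T}"
      using fourier_eq_integral[where f = "\<lambda>t y. dt T I t y * grad (I t) y $ k" and x = x and T = T and \<nu> = \<omega>] cG cH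
      by (auto simp: G_def[abs_def] H_def[abs_def] has_integral_integral continuous_on_mult)
    \<comment> \<open>Both sides of the claim are integrals over \<open>[0, T]\<close>. The
      integrands are shown to agree pointwise, and uniqueness of the integral finishes.\<close>
    have "((\<lambda>t. (\<Sum>l\<in>UNIV. complex_of_real (G k t * G l t) * exp (- (\<i> * complex_of_real (t * (2 * \<omega>)))) * cnj (a x $ l))
      + (\<Sum>l\<in>UNIV. complex_of_real (G k t * G l t) * exp (- (\<i> * complex_of_real (t * 0))) * a x $ l)
      + 2 * (complex_of_real (H t * G k t) * exp (- (\<i> * complex_of_real (t * \<omega>))))) has_integral
     ((\<Sum>l\<in>UNIV. fourier T (\<lambda>t y. grad (I t) y $ k * grad (I t) y $ l) (2 * \<omega>) x * cnj (a x $ l))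
    + (\<Sum>l\<in>UNIV. fourier T (\<lambda>t y. grad (I t) y $ k * grad (I t) y $ l) 0 x * a x $ l)
    + 2 * fourier T (\<lambda>t y. dt T I t y * grad (I t) y $ k) \<omega> x)) {0..T}"
      by (intro has_integral_add has_integral_sum has_integral_mult_left has_integral_mult_right int int') auto
    moreover have "(\<Sum>l\<in>UNIV. complex_of_real (G k t * G l t) * exp (- (\<i> * complex_of_real (t * (2 * \<omega>)))) * cnj (a x $ l))
      + (\<Sum>l\<in>UNIV. complex_of_real (G k t * G l t) * exp (- (\<i> * complex_of_real (t * 0))) * a x $ l)
      + 2 * (complex_of_real (H t * G k t) * exp (- (\<i> * complex_of_real (t * \<omega>))))
      = 2 * (((grad (I t) x \<bullet> hvec \<omega> t (a x) + dt T I t x) *\<^sub>R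
         (\<chi> k. complex_of_real (grad (I t) x $ k) * cnj (?e t))) $ k)" for t
    proof -
      have e1: "exp (- (\<i> * complex_of_real (t * \<omega>))) = cnj (?e t)"
        by (simp add: exp_cnj)
      have e2: "exp (- (\<i> * complex_of_real (t * (2 * \<omega>)))) = cnj (?e t) * cnj (?e t)"
        by (simp add: exp_cnj exp_add[symmetric] mult_ac)
      have e3: "?e t * cnj (?e t) = 1" by (simp add: exp_cnj exp_add[symmetric])
      \<comment> \<open>The splitting into the two frequencies for one component, from
        \<open>2 * Re z = z + cnj z\<close> and the unit modulus \<open>e3\<close> of the
        exponential.\<close>
      have "2 * complex_of_real (G l t * Re (a x $ l * ?e t)) * cnj (?e t) =
        complex_of_real (G l t) * (cnj (?e t) * cnj (?e t)) * cnj (a x $ l) + complex_of_real (G l t) * a x $ l" for l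
      proof -
        have "2 * complex_of_real (Re (a x $ l * ?e t)) = a x $ l * ?e t + cnj (a x $ l) * cnj (?e t)"
          using complex_add_cnj[of "a x $ l * ?e t"] by simp
        then have "2 * complex_of_real (Re (a x $ l * ?e t)) * cnj (?e t) = a x $ l * (?e t * cnj (?e t)) + cnj (a x $ l) * (cnj (?e t) * cnj (?e t))"
          by (simp only:) (simp only: algebra_simps)
        moreover have "2 * complex_of_real (G l t * Re (a x $ l * ?e t)) * cnj (?e t) =
            complex_of_real (G l t) * (2 * complex_of_real (Re (a x $ l * ?e t)) * cnj (?e t))"
          by (simp only: of_real_mult mult_ac)
        ultimately show ?thesis unfolding e3 by (simp only: distrib_left mult_ac mult_1_right) (simp add: add.commute)
      qed
      then have "2 * complex_of_real (\<Sum>l\<in>UNIV. G l t * Re (a x $ l * ?e t)) * cnj (?e t) =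
        (\<Sum>l\<in>UNIV. complex_of_real (G l t) * (cnj (?e t) * cnj (?e t)) * cnj (a x $ l)) + (\<Sum>l\<in>UNIV. complex_of_real (G l t) * a x $ l)"
        by (simp add: sum_distrib_left sum_distrib_right sum.distrib)
      moreover have "grad (I t) x \<bullet> hvec \<omega> t (a x) = (\<Sum>l\<in>UNIV. G l t * Re (a x $ l * ?e t))"
        by (simp add: inner_vec_def hvec_def G_def)
      ultimately have *: "2 * complex_of_real (grad (I t) x \<bullet> hvec \<omega> t (a x)) * cnj (?e t) =
        (\<Sum>l\<in>UNIV. complex_of_real (G l t) * (cnj (?e t) * cnj (?e t)) * cnj (a x $ l)) + (\<Sum>l\<in>UNIV. complex_of_real (G l t) * a x $ l)"
        by simp
      have "2 * (((grad (I t) x \<bullet> hvec \<omega> t (a x) + dt T I t x) *\<^sub>R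
         (\<chi> k. complex_of_real (grad (I t) x $ k) * cnj (?e t))) $ k)
        = complex_of_real (G k t) * (2 * complex_of_real (grad (I t) x \<bullet> hvec \<omega> t (a x)) * cnj (?e t))
          + 2 * (complex_of_real (H t) * complex_of_real (G k t) * cnj (?e t))"
        unfolding vector_scaleR_component vec_lambda_beta
        by (simp add: scaleR_conv_of_real G_def H_def algebra_simps)
      also have "\<dots> = (\<Sum>l\<in>UNIV. complex_of_real (G k t * G l t) * (cnj (?e t) * cnj (?e t)) * cnj (a x $ l))
          + (\<Sum>l\<in>UNIV. complex_of_real (G k t * G l t) * a x $ l)
          + 2 * (complex_of_real (H t) * complex_of_real (G k t) * cnj (?e t))"
        unfolding * by (simp add: sum_distrib_left algebra_simps)
      finally show ?thesis unfolding e1 e2 by simp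
    qed
    moreover have "((\<lambda>t. 2 * (((grad (I t) x \<bullet> hvec \<omega> t (a x) + dt T I t x) *\<^sub>R
         (\<chi> k. complex_of_real (grad (I t) x $ k) * cnj (?e t))) $ k)) has_integral 2 * data_term T \<omega> I a x $ k) {0..T}"
    proof -
      have "(\<lambda>t. (grad (I t) x \<bullet> hvec \<omega> t (a x) + dt T I t x) *\<^sub>R
         (\<chi> k. complex_of_real (grad (I t) x $ k) * cnj (?e t))) integrable_on {0..T}"
        by (rule integrable_continuous_real,
          rule continuous_on_slice[OF continuous_on_data_term_integrand[OF assms(1-4)] assms(5)])
      from has_integral_mult_right[OF has_integral_linear[OF integrable_integral[OF this] bounded_linear_vec_nth[of k]], of 2]
      show ?thesis by (simp only: o_def data_term_def)
    qed
    ultimately show ?thesis by (simp only: has_integral_unique)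
  qed
  then show ?thesis
    by (simp add: vec_eq_iff fourier_mat_def fourier_vec_def outer_def cnj_vec_def matrix_vector_mult_def
        scaleR_conv_of_real[where 'a = complex])
qed

text \<open>The field and its Jacobian are real-linear in the amplitude and the density is a sum of
  squares, so the expansion in the real parameter \<open>s\<close> is exact.\<close>

lemma energy_density_perturb:
  fixes I :: "real \<Rightarrow> real^'n::finite \<Rightarrow> real"
  assumes "open \<Omega>" "C2_on \<Omega> a" "C2_on \<Omega> b" "x \<in> \<Omega>"
  shows "energy_density T \<omega> lam I (\<lambda>y. a y + s *\<^sub>R b y) t x = energy_density T \<omega> lam I a t x
    + 2 * s * ((grad (I t) x \<bullet> hvec \<omega> t (a x) + dt T I t x) * (grad (I t) x \<bullet> hvec \<omega> t (b x))
        + lam * (hmat \<omega> t (cjac a x) \<bullet> hmat \<omega> t (cjac b x)))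
    + s\<^sup>2 * ((grad (I t) x \<bullet> hvec \<omega> t (b x))\<^sup>2 + lam * (norm (hmat \<omega> t (cjac b x)))\<^sup>2)"
proof -
  have "pderiv_at j (\<lambda>y. a y $ k + s *\<^sub>R b y $ k) x = pderiv_at j (\<lambda>y. a y $ k) x + s *\<^sub>R pderiv_at j (\<lambda>y. b y $ k) x" for j k
  proof -
    have C1: "C1_on \<Omega> (\<lambda>y. a y $ k)" "C1_on \<Omega> (\<lambda>y. b y $ k)" "C1_on \<Omega> (\<lambda>y. s *\<^sub>R b y $ k)"
      by (intro C1_on_bounded_linear[OF bounded_linear_scaleR_right] C2_on_C1_on C2_on_nth assms(2,3))+
    show ?thesis
      using pderiv_at_add[OF assms(1) C1(1,3) assms(4)]
        pderiv_at_bounded_linear[OF assms(1) C1(2) bounded_linear_scaleR_right assms(4)] by simp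
  qed
  then have cj: "cjac (\<lambda>y. a y + s *\<^sub>R b y) x = cjac a x + s *\<^sub>R cjac b x"
    by (simp add: cjac_def vec_eq_iff)
  show ?thesis
    unfolding energy_density_def cj hvec_add hmat_add hvec_scaleR hmat_scaleR power2_norm_eq_inner
    by (simp add: inner_add_left inner_add_right inner_commute power2_eq_square algebra_simps)
qed

lemma cjac_scaleR_const:
  assumes "open S" "C2_on S f" "x \<in> S"
  shows "cjac (\<lambda>y. f y *\<^sub>R c) x = (\<chi> k j. pderiv_at j f x *\<^sub>R c $ k)"
  by (simp add: cjac_def vec_eq_iff
      pderiv_at_bounded_linear[OF assms(1) C2_on_C1_on[OF assms(2)] bounded_linear_scaleR_left assms(3)])

section \<open>The Euler--Lagrange equation\<close>

theorem theorem3: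
  fixes \<Omega> :: "(real^'n::finite) set"
    and \<omega> T lam :: real
    and p :: nat
    and I :: "real \<Rightarrow> real^'n \<Rightarrow> real"
    and v :: "real \<Rightarrow> real^'n \<Rightarrow> real^'n"
    and a :: "real^'n \<Rightarrow> complex^'n"
  assumes "open \<Omega>" "connected \<Omega>" "\<Omega> \<noteq> {}" "bounded \<Omega>"
    and "T = 2 * pi * real p / \<omega>" "T > 0"
    and "lam > 0"
    and "C1_on ({0..T} \<times> \<Omega>) (\<lambda>(t, x). I t x)"
    and "has_amplitude T \<Omega> \<omega> v a"
    and "energy T \<Omega> lam I v < \<infinity>"
    and "\<forall>w \<in> harmonic_fields T \<Omega> \<omega>. energy T \<Omega> lam I v \<le> energy T \<Omega> lam I w"
  shows "\<forall>x\<in>\<Omega>.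
    (lam * T) *\<^sub>R laplacian a x =
      fourier_mat T (\<lambda>t y. outer (grad (I t) y) (grad (I t) y)) (2 * \<omega>) x *v cnj_vec (a x)
    + fourier_mat T (\<lambda>t y. outer (grad (I t) y) (grad (I t) y)) 0 x *v a x
    + 2 *\<^sub>R fourier_vec T (\<lambda>t y. dt T I t y *\<^sub>R grad (I t) y) \<omega> x"
proof
  fix x0 assume x0: "x0 \<in> \<Omega>"
  have C2a: "C2_on \<Omega> a" using assms(9) by (simp add: has_amplitude_def)
  then have ca: "continuous_on \<Omega> a" by (intro C1_on_continuous_on C2_on_C1_on)
  define W where "W = data_term T \<omega> I a"
  define D where "D j k = pderiv_at j (\<lambda>y. a y $ k)" for j k
  have C1D: "C1_on \<Omega> (D j k)" for j k
    unfolding D_def by (intro C2_on_pderiv_at[OF assms(1)] C2_on_nth C2a)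
  \<comment> \<open>Half the difference between the right and left sides of the claimed equation,
    once \<open>W\<close> is expanded by \<open>data_term_eq_fourier\<close>.\<close>
  define Q where "Q x = W x - (lam * T / 2) *\<^sub>R laplacian a x" for x
  have lap: "laplacian a x = (\<chi> k. \<Sum>j\<in>UNIV. pderiv_at j (D j k) x)" for x
    by (simp add: laplacian_def D_def)
  have cW: "continuous_on \<Omega> W"
    unfolding W_def data_term_def[abs_def]
    by (rule continuous_on_integral_param[OF continuous_on_data_term_integrand[OF assms(1,6,8) ca]])
  have clap: "continuous_on \<Omega> (laplacian a)"
    unfolding lap[abs_def] by (intro continuous_intros C1_on_pderiv_at(2)[OF assms(1)] C1D)
  have cQ: "continuous_on \<Omega> Q" unfolding Q_def[abs_def] by (intro continuous_intros cW clap)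
  \<comment> \<open>The inner product is the real one on complex vectors. Letting \<open>c\<close>
    range over all complex vectors tests real and imaginary parts together.\<close>
  have "c \<bullet> Q x0 = 0" for c
  proof (rule bump_test_eq_0[OF assms(1) _ x0])
    show "continuous_on \<Omega> (\<lambda>x. c \<bullet> Q x)" by (intro continuous_intros cQ)
    fix r :: real assume r: "r > 0" "cball x0 r \<subseteq> \<Omega>"
    let ?\<phi> = "bump x0 r"
    let ?b = "\<lambda>y. ?\<phi> y *\<^sub>R c"
    have C2\<phi>: "C2_on S ?\<phi>" for S by (rule C2_on_bump)
    have C2b: "C2_on \<Omega> ?b" by (rule C2_on_bounded_linear[OF bounded_linear_scaleR_left C2\<phi>])
    have cjb: "cjac ?b x = (\<chi> k j. pderiv_at j ?\<phi> x *\<^sub>R c $ k)" if "x \<in> \<Omega>" for x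
      by (rule cjac_scaleR_const[OF assms(1) C2\<phi> that])
    have \<phi>0: "?\<phi> x = 0" if "x \<notin> cball x0 r" for x
      using bump_eq_0[OF r(1), of x x0] that by auto
    have d\<phi>0: "pderiv_at j ?\<phi> x = 0" if "x \<notin> cball x0 r" for x j
      by (rule pderiv_at_bump_eq_0[OF r(1) that])
    \<comment> \<open>\<open>B\<close> is half the coefficient of \<open>s\<close> and
      \<open>C\<close> the coefficient of the square of \<open>s\<close> in the perturbed
      density.\<close>
    define B where "B t x = (grad (I t) x \<bullet> hvec \<omega> t (a x) + dt T I t x) * (grad (I t) x \<bullet> hvec \<omega> t (?b x))
        + lam * (hmat \<omega> t (cjac a x) \<bullet> hmat \<omega> t (cjac ?b x))" for t x
    define C where "C t x = (grad (I t) x \<bullet> hvec \<omega> t (?b x))\<^sup>2 + lam * (norm (hmat \<omega> t (cjac ?b x)))\<^sup>2" for t x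
    define g where "g t x = energy_density T \<omega> lam I a t x" for t x
    have C2s: "C2_on \<Omega> (\<lambda>y. a y + s *\<^sub>R ?b y)" for s
      by (intro C2_on_add C2a C2_on_bounded_linear[OF bounded_linear_scaleR_right C2b])
    \<comment> \<open>The bump is twice continuously differentiable, so each perturbed field is an
      admissible competitor.\<close>
    have amp: "has_amplitude T \<Omega> \<omega> (\<lambda>t x. hvec \<omega> t (a x + s *\<^sub>R ?b x)) (\<lambda>y. a y + s *\<^sub>R ?b y)" for s
      using C2s unfolding has_amplitude_def hvec_def by simp
    note en = energy_harmonic[OF assms(1,6,7,8)]
    have "continuous_on ({0..T} \<times> \<Omega>) (\<lambda>p. a (snd p))" "continuous_on ({0..T} \<times> \<Omega>) (\<lambda>p. cjac a (snd p))"
      "continuous_on ({0..T} \<times> \<Omega>) (\<lambda>p. ?b (snd p))" "continuous_on ({0..T} \<times> \<Omega>) (\<lambda>p. cjac ?b (snd p))"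
      by (rule continuous_on_snd_Times,
          rule continuous_on_cjac[OF assms(1)] C1_on_continuous_on[OF C2_on_C1_on], rule C2a C2b)+
    moreover have "continuous_on ({0..T} \<times> \<Omega>) (\<lambda>p. ?\<phi> (snd p))"
      by (intro continuous_on_snd_Times C1_on_continuous_on[OF C2_on_C1_on] C2\<phi>)
    ultimately have cB: "continuous_on ({0..T} \<times> \<Omega>) (\<lambda>(t, x). B t x)"
      and cC: "continuous_on ({0..T} \<times> \<Omega>) (\<lambda>(t, x). C t x)"
      unfolding B_def C_def case_prod_unfold
      using continuous_on_dt_grad[OF assms(1,6,8)]
      by (intro continuous_intros; simp add: case_prod_unfold)+
    have cg: "continuous_on ({0..T} \<times> \<Omega>) (\<lambda>(t, x). g t x)"
      unfolding g_def by (rule en(1)[OF assms(9)])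
    have exp: "energy_density T \<omega> lam I (\<lambda>y. a y + s *\<^sub>R ?b y) t x = g t x + 2 * s * B t x + s\<^sup>2 * C t x" if "x \<in> \<Omega>" for s t x
      unfolding g_def B_def C_def by (rule energy_density_perturb[OF assms(1) C2a C2b that])
    let ?J = "\<lambda>f x. integral {0..T} (\<lambda>t. f t x)"
    have Jexp: "?J (energy_density T \<omega> lam I (\<lambda>y. a y + s *\<^sub>R ?b y)) x = ?J g x + 2 * s * ?J B x + s\<^sup>2 * ?J C x" if x: "x \<in> \<Omega>" for s x
    proof -
      have "(\<lambda>t. f t x) integrable_on {0..T}" if "continuous_on ({0..T} \<times> \<Omega>) (\<lambda>(t, x). f t x)" for f :: "real \<Rightarrow> real^'n \<Rightarrow> real"
        by (rule integrable_continuous_real[OF continuous_on_slice[OF that x]])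
      from this[OF cg] this[OF cB] this[OF cC]
      have "((\<lambda>t. g t x + 2 * s * B t x + s\<^sup>2 * C t x) has_integral (?J g x + 2 * s * ?J B x + s\<^sup>2 * ?J C x)) {0..T}"
        by (intro has_integral_add has_integral_mult_right integrable_integral)
      then show ?thesis unfolding exp[OF x] by (rule integral_unique)
    qed
    have \<beta>0: "(LINT x:\<Omega>|lborel. ?J B x) = 0"
    proof (rule first_variation_eq_0[OF assms(1) compact_cball r(2), of "?J g" _ "?J C"])
      show "continuous_on \<Omega> (?J g)" "continuous_on \<Omega> (?J B)" "continuous_on \<Omega> (?J C)"
        by (intro continuous_on_integral_param cg cB cC)+
      fix s
      show "?J B x = 0" "?J C x = 0" if "x \<in> \<Omega> - cball x0 r" for x
        using that \<phi>0[of x] d\<phi>0[of x] cjb[of x]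
        by (auto simp: B_def C_def hvec_def hmat_def inner_vec_def zero_vec_def[symmetric] norm_vec_def L2_set_def)
      \<comment> \<open>The polynomial is the time integral of the perturbed density, which is a sum
        of nonnegative terms.\<close>
      show "0 \<le> ?J g x + 2 * s * ?J B x + s\<^sup>2 * ?J C x" if x: "x \<in> \<Omega>" for x
        unfolding Jexp[OF x, symmetric]
        by (rule integral_nonneg[OF integrable_continuous_real[OF continuous_on_slice[OF en(1)[OF amp] x]]])
          (use assms(7) in \<open>simp add: energy_density_def\<close>)
      have eg: "(\<integral>\<^sup>+x\<in>\<Omega>. ennreal (?J g x) \<partial>lborel) = energy T \<Omega> lam I v"
        unfolding g_def by (rule en(2)[OF assms(9), symmetric])
      show "(\<integral>\<^sup>+x\<in>\<Omega>. ennreal (?J g x) \<partial>lborel) < \<infinity>" unfolding eg by (rule assms(10))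
      have "energy T \<Omega> lam I v \<le> energy T \<Omega> lam I (\<lambda>t x. hvec \<omega> t (a x + s *\<^sub>R ?b x))"
        using assms(11) amp[of s] unfolding harmonic_fields_def by blast
      also have "\<dots> = (\<integral>\<^sup>+x\<in>\<Omega>. ennreal (?J g x + 2 * s * ?J B x + s\<^sup>2 * ?J C x) \<partial>lborel)"
        unfolding en(2)[OF amp]
      proof (intro nn_integral_cong)
        fix x
        show "ennreal (?J (energy_density T \<omega> lam I (\<lambda>y. a y + s *\<^sub>R ?b y)) x) * indicator \<Omega> x
          = ennreal (?J g x + 2 * s * ?J B x + s\<^sup>2 * ?J C x) * indicator \<Omega> x"
          by (cases "x \<in> \<Omega>") (simp_all only: Jexp indicator_simps mult_zero_right simp_thms)
      qed
      finally show "(\<integral>\<^sup>+x\<in>\<Omega>. ennreal (?J g x) \<partial>lborel) \<le> (\<integral>\<^sup>+x\<in>\<Omega>. ennreal (?J g x + 2 * s * ?J B x + s\<^sup>2 * ?J C x) \<partial>lborel)"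
        unfolding eg .
    qed
    \<comment> \<open>The real functions to be integrated by parts against the bump; their partial
      derivatives in direction \<open>j\<close> add up to
      \<open>c \<bullet> laplacian a x\<close>.\<close>
    let ?f = "\<lambda>k j x. c $ k \<bullet> D j k x"
    have C1f: "C1_on \<Omega> (?f k j)" for k j
      by (rule C1_on_bounded_linear[OF bounded_linear_inner_right C1D])
    let ?P = "\<lambda>k j x. pderiv_at j ?\<phi> x * ?f k j x + ?\<phi> x * pderiv_at j (?f k j) x"
    \<comment> \<open>Integration in time: \<open>inner_hvec\<close> turns the data part into
      \<open>c \<bullet> W x\<close>, and the harmonic mean value \<open>T / 2\<close> turns the
      smoothness part into an inner product of complex Jacobians.\<close>
    have JB: "?J B x = ?\<phi> x * (c \<bullet> W x) + (lam * T / 2) * (\<Sum>k\<in>UNIV. \<Sum>j\<in>UNIV. pderiv_at j ?\<phi> x * ?f k j x)" if x: "x \<in> \<Omega>" for x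
    proof -
      let ?N = "\<lambda>t. (grad (I t) x \<bullet> hvec \<omega> t (a x) + dt T I t x)"
      let ?w = "\<lambda>t. ?N t *\<^sub>R (\<chi> k. complex_of_real (grad (I t) x $ k) * cnj (exp (\<i> * complex_of_real (t * \<omega>))))"
      have "?w integrable_on {0..T}"
        by (rule integrable_continuous_real,
          rule continuous_on_slice[OF continuous_on_data_term_integrand[OF assms(1,6,8) ca] x])
      from has_integral_linear[OF integrable_integral[OF this] bounded_linear_inner_right[of c]]
      have "((\<lambda>t. c \<bullet> ?w t) has_integral (c \<bullet> W x)) {0..T}"
        by (simp only: W_def data_term_def o_def)
      then have "((\<lambda>t. ?N t * (grad (I t) x \<bullet> hvec \<omega> t c)) has_integral (c \<bullet> W x)) {0..T}"
        by (simp only: inner_hvec inner_scaleR_right)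
      from has_integral_add[OF has_integral_mult_right[OF this, of "?\<phi> x"]
          has_integral_mult_right[OF has_integral_inner_hmat[OF assms(5,6)], of lam "cjac a x" "cjac ?b x"]]
      have "?J B x = ?\<phi> x * (c \<bullet> W x) + lam * (T / 2 * (cjac a x \<bullet> cjac ?b x))"
        by (intro integral_unique) (simp add: B_def hvec_scaleR mult_ac)
      moreover have "cjac a x \<bullet> cjac ?b x = (\<Sum>k\<in>UNIV. \<Sum>j\<in>UNIV. pderiv_at j ?\<phi> x * ?f k j x)"
        unfolding cjb[OF x] by (simp add: cjac_def D_def inner_vec_def inner_commute)
      ultimately show ?thesis by simp
    qed
    have dP: "pderiv_at j (?f k j) x = c $ k \<bullet> pderiv_at j (D j k) x" if "x \<in> \<Omega>" for k j x
      by (rule pderiv_at_bounded_linear[OF assms(1) C1D bounded_linear_inner_right that])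
    \<comment> \<open>Subtracting the product-rule expressions \<open>?P\<close> removes the terms
      with derivatives of the bump and leaves the Laplacian with a minus sign, as in
      \<open>Q\<close>.\<close>
    have eq: "?\<phi> x * (c \<bullet> Q x) = ?J B x - (lam * T / 2) * (\<Sum>k\<in>UNIV. \<Sum>j\<in>UNIV. ?P k j x)" if x: "x \<in> \<Omega>" for x
    proof -
      have "c \<bullet> laplacian a x = (\<Sum>k\<in>UNIV. \<Sum>j\<in>UNIV. pderiv_at j (?f k j) x)"
        by (simp add: lap inner_vec_def inner_sum_right dP[OF x])
      then show ?thesis unfolding JB[OF x] Q_def
        by (simp add: inner_diff_right sum.distrib sum_distrib_left algebra_simps)
    qed
    have iP: "set_integrable lborel \<Omega> (?P k j)" for k j
      by (rule set_integrable_compact_support[OF compact_cball r(2)])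
        (auto intro!: continuous_on_add continuous_on_mult C1_on_pderiv_at(2)[OF assms(1)] C1f
          C1_on_continuous_on[OF C1f] C2_on_C1_on[OF C2\<phi>] C1_on_continuous_on[OF C2_on_C1_on[OF C2\<phi>]] simp: \<phi>0 d\<phi>0)
    have iB: "set_integrable lborel \<Omega> (?J B)"
    proof (rule set_integrable_compact_support[OF compact_cball r(2) continuous_on_integral_param[OF cB]])
      show "?J B x = 0" if "x \<in> \<Omega> - cball x0 r" for x
        using that \<phi>0[of x] d\<phi>0[of x] JB[of x] by auto
    qed
    have "(LINT x:\<Omega>|lborel. ?\<phi> x * (c \<bullet> Q x)) = (LINT x:\<Omega>|lborel. ?J B x - (lam * T / 2) * (\<Sum>k\<in>UNIV. \<Sum>j\<in>UNIV. ?P k j x))"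
      by (rule set_lebesgue_integral_cong) (use assms(1) eq in auto)
    also have "\<dots> = (LINT x:\<Omega>|lborel. ?J B x) - (lam * T / 2) * (\<Sum>k\<in>UNIV. \<Sum>j\<in>UNIV. (LINT x:\<Omega>|lborel. ?P k j x))"
    proof -
      have "set_integrable lborel \<Omega> (\<lambda>x. lam * T / 2 * (\<Sum>k\<in>UNIV. \<Sum>j\<in>UNIV. ?P k j x))"
        by (intro set_integrable_mult_right set_integral_sum(1) iP)
      moreover have "(LINT x:\<Omega>|lborel. (\<Sum>k\<in>UNIV. \<Sum>j\<in>UNIV. ?P k j x)) =
          (\<Sum>k\<in>UNIV. \<Sum>j\<in>UNIV. (LINT x:\<Omega>|lborel. ?P k j x))"
        by (simp only: set_integral_sum iP)
      ultimately show ?thesis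
        by (simp only: set_integral_diff(2)[OF iB] set_integral_mult_right)
    qed
    \<comment> \<open>The first integral is the vanishing first variation; each of the others
      vanishes by integration by parts.\<close>
    also have "\<dots> = 0"
      unfolding \<beta>0 integral_bump_by_parts[OF assms(1) C1f r] by simp
    finally show "(LINT x:\<Omega>|lborel. ?\<phi> x * (c \<bullet> Q x)) = 0" .
  qed
  \<comment> \<open>Choose \<open>c\<close> to be \<open>Q x0\<close> itself.\<close>
  then have "Q x0 = 0" using inner_eq_zero_iff by blast
  then have "(lam * T) *\<^sub>R laplacian a x0 = 2 *\<^sub>R W x0"
    by (simp add: Q_def)
  then show "(lam * T) *\<^sub>R laplacian a x0 =
      fourier_mat T (\<lambda>t y. outer (grad (I t) y) (grad (I t) y)) (2 * \<omega>) x0 *v cnj_vec (a x0)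
    + fourier_mat T (\<lambda>t y. outer (grad (I t) y) (grad (I t) y)) 0 x0 *v a x0
    + 2 *\<^sub>R fourier_vec T (\<lambda>t y. dt T I t y *\<^sub>R grad (I t) y) \<omega> x0"
    using data_term_eq_fourier[OF assms(1,6,8) ca x0] by (simp only: W_def)
qed

end
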